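(* Let $\Psi:\mathrm{QSym}\to\mathrm{QSym}$ be the linear map with $\Psi(F_\alpha)=F_{\alpha^c}$ for every composition $\alpha$. Then $\Psi$ is the only nontrivial (i.e. non-identity) graded Hopf algebra automorphism of $\mathrm{QSym}$ that takes the set $\{F_\alpha:\alpha\in\mathcal{C}\}$ of fundamental quasisymmetric functions onto itself. (That is, $\Psi$ is such an automorphism, and every such automorphism other than the identity equals $\Psi$.)
   Context: A composition is a finite (possibly empty) ordered list $\alpha=(\alpha_1,\dots,\alpha_k)$ of positive integers; $|\alpha|=\alpha_1+\cdots+\alpha_k$, and $\mathcal{C}$ is the set of all compositions ($\emptyset$ is the empty one). For a composition $\alpha$ of $n\ge1$ let $\mathrm{Set}(\alpha)=\{\alpha_1,\alpha_1+\alpha_2,\dots,\alpha_1+\cdots+\alpha_{k-1}\}\subseteq\{1,\dots,n-1\}$; this is a bijection between compositions of $n$ and subsets of $\{1,\dots,n-1\}$. The complement $\alpha^c$ is the composition of $n$ with $\mathrm{Set}(\alpha^c)=\{1,\dots,n-1\}\setminus\mathrm{Set}(\alpha)$, and $\emptyset^c=\emptyset$. $\mathrm{QSym}$ is the set of bounded-degree formal power series $f\in\mathbb{Q}[[x_1,x_2,\dots]]$ such that for each composition $(\alpha_1,\dots,\alpha_k)$ all monomials $x_{i_1}^{\alpha_1}\cdots x_{i_k}^{\alpha_k}$ with $i_1<\cdots<i_k$ have the same coefficient in $f$. Let $M_\emptyset=1$ and $M_\alpha=\sum_{i_1<\cdots<i_k}x_{i_1}^{\alpha_1}\cdots x_{i_k}^{\alpha_k}$.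 Write $\beta\preceq\alpha$ if $\alpha$ is obtained from $\beta$ by summing some consecutive parts of $\beta$. The fundamental basis is $F_\emptyset=1$, $F_\alpha=\sum_{\beta\preceq\alpha}M_\beta$. $\mathrm{QSym}=\bigoplus_{n\ge0}\mathrm{QSym}_n$ is a connected graded Hopf algebra over $\mathbb{Q}$ with $\mathrm{QSym}_n=\mathrm{span}\{M_\alpha:|\alpha|=n\}=\mathrm{span}\{F_\alpha:|\alpha|=n\}$, the product of power series, coproduct $\Delta(M_\alpha)=\sum_{\alpha=\beta\cdot\gamma}M_\beta\otimes M_\gamma$ (all deconcatenations, empty compositions allowed), and counit $\varepsilon(M_\emptyset)=1$, $\varepsilon(M_\alpha)=0$ for $\alpha\neq\emptyset$. A map is graded if it maps $\mathrm{QSym}_n$ into $\mathrm{QSym}_n$ for all $n$. *)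

theory Defs
  imports Complex_Main "HOL-Library.Poly_Mapping"
begin

definition compositions :: "nat list set" where
  "compositions = {\<alpha>. 0 \<notin> set \<alpha>}"

definition comp_set :: "nat list \<Rightarrow> nat set" where
  "comp_set \<alpha> = {sum_list (take i \<alpha>) | i. 1 \<le> i \<and> i < length \<alpha>}"

text \<open>
  For the empty composition the defining condition also forces the empty composition, so it needs
  no separate clause.  Existence and uniqueness are \<open>ex1_comp_compl\<close> below.
\<close>

definition comp_compl :: "nat list \<Rightarrow> nat list" where
  "comp_compl \<alpha> = (THE \<beta>. \<beta> \<in> compositions \<and> sum_list \<beta> = sum_list \<alpha> \<and>
     comp_set \<beta> = {1..<sum_list \<alpha>} - comp_set \<alpha>)"

text \<open>\<open>refines \<beta> \<alpha>\<close> is \<open>\<beta> \<preceq> \<alpha>\<close>: the list \<open>\<beta>\<close> is cut into nonempty consecutive blocks,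
  whose sums are the parts of \<open>\<alpha>\<close>.\<close>

definition refines :: "nat list \<Rightarrow> nat list \<Rightarrow> bool" where
  "refines \<beta> \<alpha> \<longleftrightarrow> (\<exists>bs. concat bs = \<beta> \<and> map sum_list bs = \<alpha> \<and> [] \<notin> set bs)"

lemma comp_set_Nil [simp]: "comp_set [] = {}"
  by (simp add: comp_set_def)

lemma comp_set_Cons:
  "comp_set (a # \<alpha>) = (if \<alpha> = [] then {} else insert a ((+) a ` comp_set \<alpha>))"
proof (cases "\<alpha> = []")
  case True
  then show ?thesis by (auto simp: comp_set_def)
next
  case False
  have "comp_set (a # \<alpha>) = {sum_list (take (Suc i) (a # \<alpha>)) | i. i < length \<alpha>}"
    unfolding comp_set_def
  proof safe
    fix i assume "1 \<le> i" "i < length (a # \<alpha>)"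
    then show "\<exists>k. sum_list (take i (a # \<alpha>)) = sum_list (take (Suc k) (a # \<alpha>)) \<and> k < length \<alpha>"
      by (intro exI[of _ "i - 1"]) auto
  next
    fix i assume "i < length \<alpha>"
    then show "\<exists>k. sum_list (take (Suc i) (a # \<alpha>)) = sum_list (take k (a # \<alpha>)) \<and> 1 \<le> k \<and> k < length (a # \<alpha>)"
      by (intro exI[of _ "Suc i"]) auto
  qed
  also have "\<dots> = {a + sum_list (take i \<alpha>) | i. i < length \<alpha>}" by simp
  also have "\<dots> = insert a ((+) a ` comp_set \<alpha>)" (is "?L = ?R")
  proof
    show "?L \<subseteq> ?R"
    proof
      fix x assume "x \<in> ?L"
      then obtain i where "i < length \<alpha>" "x = a + sum_list (take i \<alpha>)" by auto
      then show "x \<in> ?R"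
      proof (cases "i = 0")
        case False
        then have "sum_list (take i \<alpha>) \<in> comp_set \<alpha>"
          using \<open>i < length \<alpha>\<close> unfolding comp_set_def by force
        then show ?thesis using \<open>x = _\<close> by blast
      qed simp
    qed
    have "a \<in> ?L" using False by (auto intro!: exI[of _ 0])
    then show "?R \<subseteq> ?L" by (auto simp: comp_set_def)
  qed
  finally show ?thesis using False by simp
qed

lemma comp_set_subset:
  assumes "\<alpha> \<in> compositions" shows "comp_set \<alpha> \<subseteq> {1..<sum_list \<alpha>}"
  using assms
proof (induction \<alpha>)
  case (Cons a \<alpha>)
  have "\<alpha> \<noteq> [] \<Longrightarrow> sum_list \<alpha> > 0"
    using Cons.prems by (cases \<alpha>) (auto simp: compositions_def)
  moreover have "comp_set \<alpha> \<subseteq> {1..<sum_list \<alpha>}" "a > 0"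
    using Cons by (auto simp: compositions_def)
  ultimately show ?case by (auto simp: comp_set_Cons)
qed simp

lemma comp_set_inj:
  assumes "\<alpha> \<in> compositions" "\<beta> \<in> compositions" "sum_list \<alpha> = sum_list \<beta>" "comp_set \<alpha> = comp_set \<beta>"
  shows "\<alpha> = \<beta>"
  using assms
proof (induction \<alpha> arbitrary: \<beta>)
  case Nil
  then show ?case by (cases \<beta>) (auto simp: compositions_def)
next
  case (Cons a \<alpha>)
  then obtain b \<beta>' where \<beta>: "\<beta> = b # \<beta>'" by (cases \<beta>) (auto simp: compositions_def)
  have c: "\<alpha> \<in> compositions" "\<beta>' \<in> compositions"
    using Cons.prems \<beta> by (auto simp: compositions_def)
  have eq: "comp_set (a # \<alpha>) = comp_set (b # \<beta>')" using Cons.prems \<beta> by simp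
  show ?case
  proof (cases "\<alpha> = []")
    case True
    then have "\<beta>' = []" using eq by (auto simp: comp_set_Cons split: if_splits)
    then show ?thesis using True \<beta> Cons.prems by simp
  next
    case False
    then have ne: "\<beta>' \<noteq> []" using eq by (auto simp: comp_set_Cons split: if_splits)
    have p: "0 \<notin> comp_set \<alpha>" "0 \<notin> comp_set \<beta>'" using comp_set_subset c by fastforce+
    have eq': "insert a ((+) a ` comp_set \<alpha>) = insert b ((+) b ` comp_set \<beta>')"
      using eq False ne by (simp add: comp_set_Cons)
    have "a \<in> insert b ((+) b ` comp_set \<beta>')" "b \<in> insert a ((+) a ` comp_set \<alpha>)"
      using eq' by blast+
    then have "b \<le> a" "a \<le> b" by auto
    then have ab: "a = b" by simp
    have "(+) a ` comp_set \<alpha> = (+) a ` comp_set \<beta>'"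
    proof (rule insert_ident[THEN iffD1])
      show "a \<notin> (+) a ` comp_set \<alpha>" "a \<notin> (+) a ` comp_set \<beta>'" using p by auto
    qed (use eq' ab in simp)
    then have "comp_set \<alpha> = comp_set \<beta>'" by (simp add: inj_image_eq_iff)
    then show ?thesis using Cons.IH[OF c] Cons.prems \<beta> ab by simp
  qed
qed

lemma comp_set_surj:
  assumes "S \<subseteq> {1..<n}"
  shows "\<exists>\<alpha>\<in>compositions. sum_list \<alpha> = n \<and> comp_set \<alpha> = S"
  using assms
proof (induction n arbitrary: S rule: less_induct)
  case (less n)
  show ?case
  proof (cases "S = {}")
    case True
    show ?thesis
    proof (cases "n = 0")
      case True
      then show ?thesis using \<open>S = {}\<close> by (intro bexI[of _ "[]"]) (auto simp: compositions_def)
    next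
      case False
      then show ?thesis using \<open>S = {}\<close>
        by (intro bexI[of _ "[n]"]) (auto simp: compositions_def comp_set_Cons)
    qed
  next
    case False
    have fin: "finite S" using less.prems finite_subset by blast
    define a where "a = Min S"
    have aS: "a \<in> S" and amin: "\<And>s. s \<in> S \<Longrightarrow> a \<le> s"
      using fin False by (auto simp: a_def)
    have a: "0 < a" "a < n" using aS less.prems by force+
    define T where "T = (\<lambda>s. s - a) ` (S - {a})"
    have "T \<subseteq> {1..<n - a}"
      using amin less.prems unfolding T_def by fastforce
    then obtain \<alpha> where \<alpha>: "\<alpha> \<in> compositions" "sum_list \<alpha> = n - a" "comp_set \<alpha> = T"
      using less.IH[of "n - a" T] a by auto
    have "(+) a ` T = S - {a}"
      using amin unfolding T_def image_image by (force simp: image_iff)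
    then show ?thesis using \<alpha> a aS
      by (intro bexI[of _ "a # \<alpha>"]) (auto simp: compositions_def comp_set_Cons)
  qed
qed

lemma ex1_comp_compl:
  "\<exists>!\<beta>. \<beta> \<in> compositions \<and> sum_list \<beta> = sum_list \<alpha> \<and>
     comp_set \<beta> = {1..<sum_list \<alpha>} - comp_set \<alpha>"
proof (rule ex_ex1I)
  show "\<exists>\<beta>. \<beta> \<in> compositions \<and> sum_list \<beta> = sum_list \<alpha> \<and>
     comp_set \<beta> = {1..<sum_list \<alpha>} - comp_set \<alpha>"
    using comp_set_surj[of "{1..<sum_list \<alpha>} - comp_set \<alpha>" "sum_list \<alpha>"] by blast
qed (simp add: comp_set_inj)

lemma comp_compl:
  shows "comp_compl \<alpha> \<in> compositions" "sum_list (comp_compl \<alpha>) = sum_list \<alpha>"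
    "comp_set (comp_compl \<alpha>) = {1..<sum_list \<alpha>} - comp_set \<alpha>"
  using theI'[OF ex1_comp_compl[of \<alpha>]] unfolding comp_compl_def by blast+

lemma refines_refl: "0 \<notin> set \<alpha> \<Longrightarrow> refines \<alpha> \<alpha>"
  unfolding refines_def by (intro exI[of _ "map (\<lambda>x. [x]) \<alpha>"]) (auto simp: comp_def)

lemma refines_length:
  assumes "refines \<beta> \<alpha>"
  shows "length \<alpha> \<le> length \<beta> \<and> (length \<alpha> = length \<beta> \<longrightarrow> \<alpha> = \<beta>)"
proof -
  have "[] \<notin> set bs \<Longrightarrow> length bs \<le> length (concat bs) \<and>
      (length bs = length (concat bs) \<longrightarrow> map sum_list bs = concat bs)" for bs :: "nat list list"
  proof (induction bs)
    case (Cons b bs)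
    have b: "length b \<ge> 1" using Cons.prems by (cases b) auto
    have IH: "length bs \<le> length (concat bs)"
      "length bs = length (concat bs) \<Longrightarrow> map sum_list bs = concat bs"
      using Cons by auto
    have "map sum_list (b # bs) = concat (b # bs)" if "length (b # bs) = length (concat (b # bs))"
    proof -
      have "length b = 1" "length bs = length (concat bs)" using that b IH(1) by auto
      then show ?thesis using IH(2) by (cases b) auto
    qed
    then show ?case using b IH(1) by auto
  qed simp
  then show ?thesis using assms unfolding refines_def by (metis length_map)
qed

lemma refines_sum: "refines \<beta> \<alpha> \<Longrightarrow> sum_list \<beta> = sum_list \<alpha>"
proof -
  have "sum_list (concat bs) = sum_list (map sum_list bs)" for bs :: "nat list list"
    by (induction bs) auto
  then show "refines \<beta> \<alpha> \<Longrightarrow> sum_list \<beta> = sum_list \<alpha>" by (force simp: refines_def)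
qed

lemma length_le_sum_list: "0 \<notin> set \<alpha> \<Longrightarrow> length \<alpha> \<le> (sum_list \<alpha> :: nat)"
  by (induction \<alpha>) auto

lemma finite_compositions: "finite {\<alpha> \<in> compositions. sum_list \<alpha> = n}"
proof (rule finite_subset)
  show "{\<alpha> \<in> compositions. sum_list \<alpha> = n} \<subseteq> {\<alpha>. set \<alpha> \<subseteq> {..n} \<and> length \<alpha> \<le> n}"
    using length_le_sum_list member_le_sum_list by (fastforce simp: compositions_def)
qed (simp add: finite_lists_length_le)

lemma finite_refines: "finite {\<beta> \<in> compositions. refines \<beta> \<alpha>}"
  by (rule finite_subset[OF _ finite_compositions[of "sum_list \<alpha>"]]) (auto dest: refines_sum)

text \<open>
  The variables are \<open>x\<^sub>0, x\<^sub>1, \<dots>\<close>; a monomial is its finitely supported exponent function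
  \<open>nat \<Rightarrow>\<^sub>0 nat\<close>, and a formal power series is its coefficient function.
\<close>

type_synonym monom = "nat \<Rightarrow>\<^sub>0 nat"

definition mdegree :: "monom \<Rightarrow> nat" where
  "mdegree m = (\<Sum>i\<in>Poly_Mapping.keys m. Poly_Mapping.lookup m i)"

definition ps_one :: "monom \<Rightarrow> rat" where
  "ps_one m = (if m = 0 then 1 else 0)"

definition ps_times :: "(monom \<Rightarrow> rat) \<Rightarrow> (monom \<Rightarrow> rat) \<Rightarrow> monom \<Rightarrow> rat" where
  "ps_times f g m = (\<Sum>(p, q)\<in>{(p, q). p + q = m}. f p * g q)"

text \<open>\<open>monom_at [i\<^sub>1, \<dots>, i\<^sub>k] [a\<^sub>1, \<dots>, a\<^sub>k]\<close> is the monomial with exponent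
  \<open>a\<^sub>j\<close> at the variable of index \<open>i\<^sub>j\<close>.\<close>

definition monom_at :: "nat list \<Rightarrow> nat list \<Rightarrow> monom" where
  "monom_at js \<alpha> = sum_list (map2 Poly_Mapping.single js \<alpha>)"

definition bounded_degree :: "(monom \<Rightarrow> rat) \<Rightarrow> bool" where
  "bounded_degree f \<longleftrightarrow> (\<exists>d. \<forall>m. f m \<noteq> 0 \<longrightarrow> mdegree m \<le> d)"

definition quasisymmetric :: "(monom \<Rightarrow> rat) \<Rightarrow> bool" where
  "quasisymmetric f \<longleftrightarrow> (\<forall>\<alpha>\<in>compositions. \<forall>js ks.
     length js = length \<alpha> \<and> sorted_wrt (<) js \<and> length ks = length \<alpha> \<and> sorted_wrt (<) ks \<longrightarrow>
     f (monom_at js \<alpha>) = f (monom_at ks \<alpha>))"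

lemma finite_decomp: "finite {(p, q). p + q = (m :: monom)}"
proof -
  let ?A = "{f. \<forall>x. (x \<in> Poly_Mapping.keys m \<longrightarrow> f x \<in> {..mdegree m}) \<and> (x \<notin> Poly_Mapping.keys m \<longrightarrow> f x = 0)}"
  have "finite ?A" by (rule finite_set_of_finite_funs) auto
  moreover have "Poly_Mapping.lookup ` {p. \<exists>q. p + q = m} \<subseteq> ?A"
  proof safe
    fix p q :: monom and x
    have le: "Poly_Mapping.lookup p x \<le> Poly_Mapping.lookup (p + q) x" by (simp add: lookup_add)
    { assume "x \<in> Poly_Mapping.keys (p + q)"
      then have "Poly_Mapping.lookup (p + q) x \<le> mdegree (p + q)"
        unfolding mdegree_def by (intro member_le_sum) auto
      then show "Poly_Mapping.lookup p x \<le> mdegree (p + q)" using le by simp }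
    { assume "x \<notin> Poly_Mapping.keys (p + q)"
      then show "Poly_Mapping.lookup p x = 0" using le by (simp add: in_keys_iff) }
  qed
  ultimately have "finite (Poly_Mapping.lookup ` {p. \<exists>q. p + q = m})" using finite_subset by blast
  then have fin: "finite {p. \<exists>q. p + q = m}"
    by (rule finite_imageD) (simp add: inj_on_def poly_mapping_eqI)
  show ?thesis
  proof (rule finite_subset)
    show "{(p, q). p + q = m} \<subseteq> {p. \<exists>q. p + q = m} \<times> {p. \<exists>q. p + q = m}"
    proof (rule subrelI)
      fix p q :: monom
      assume "(p, q) \<in> {(p, q). p + q = m}"
      then have "p + q = m" "q + p = m" by (auto simp: add.commute)
      then show "(p, q) \<in> {p. \<exists>q. p + q = m} \<times> {p. \<exists>q. p + q = m}" by blast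
    qed
    show "finite ({p. \<exists>q. p + q = m} \<times> {p. \<exists>q. p + q = m})" using fin by simp
  qed
qed

lemma mdegree_add: "mdegree (p + q) = mdegree p + mdegree q"
proof -
  let ?K = "Poly_Mapping.keys p \<union> Poly_Mapping.keys q"
  have "mdegree m = (\<Sum>i\<in>?K. Poly_Mapping.lookup m i)" if "Poly_Mapping.keys m \<subseteq> ?K" for m
    unfolding mdegree_def using that by (intro sum.mono_neutral_left) (auto simp: in_keys_iff)
  then have "mdegree (p + q) = (\<Sum>i\<in>?K. Poly_Mapping.lookup (p + q) i)"
    "mdegree p = (\<Sum>i\<in>?K. Poly_Mapping.lookup p i)" "mdegree q = (\<Sum>i\<in>?K. Poly_Mapping.lookup q i)"
    using Poly_Mapping.keys_add[of p q] by auto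
  then show ?thesis by (simp add: lookup_add sum.distrib)
qed

lemma ps_times_commute: "ps_times f g = ps_times g f"
  unfolding ps_times_def
  by (rule ext, rule sum.reindex_bij_witness[of _ prod.swap prod.swap]) (auto simp: add.commute mult.commute)

lemma ps_times_one: "ps_times ps_one f = f"
proof
  fix m
  have "ps_times ps_one f m = (\<Sum>(p, q)\<in>{(0, m)}. ps_one p * f q)"
    unfolding ps_times_def using finite_decomp
  proof (intro sum.mono_neutral_right)
    show "\<forall>x\<in>{(p, q). p + q = m} - {(0, m)}. (case x of (p, q) \<Rightarrow> ps_one p * f q) = 0"
    proof
      fix x assume x: "x \<in> {(p, q). p + q = m} - {(0, m)}"
      then have "fst x \<noteq> 0" by auto
      then show "(case x of (p, q) \<Rightarrow> ps_one p * f q) = 0"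
        by (simp add: ps_one_def case_prod_unfold)
    qed
  qed auto
  then show "ps_times ps_one f m = f m" by (simp add: ps_one_def)
qed

lemma ps_times_assoc: "ps_times (ps_times f g) h = ps_times f (ps_times g h)"
proof
  fix m
  let ?D = "\<lambda>m :: monom. {(p, q). p + q = m}"
  have fin: "\<forall>x\<in>?D m. finite (?D (fst x))" "\<forall>x\<in>?D m. finite (?D (snd x))" "finite (?D m)"
    using finite_decomp by blast+
  have "ps_times (ps_times f g) h m =
      (\<Sum>x\<in>?D m. \<Sum>y\<in>?D (fst x). f (fst y) * g (snd y) * h (snd x))"
    unfolding ps_times_def by (simp add: sum_distrib_right case_prod_unfold)
  also have "\<dots> = (\<Sum>(x, y)\<in>Sigma (?D m) (\<lambda>x. ?D (fst x)). f (fst y) * g (snd y) * h (snd x))"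
    by (rule sum.Sigma[OF fin(3,1)])
  also have "\<dots> = (\<Sum>(x, y)\<in>Sigma (?D m) (\<lambda>x. ?D (snd x)). f (fst x) * (g (fst y) * h (snd y)))"
    by (rule sum.reindex_bij_witness[of _ "\<lambda>((a, r), (b, c)). ((a + b, c), (a, b))"
          "\<lambda>((p, c), (a, b)). ((a, b + c), (b, c))"]) (auto simp: algebra_simps)
  also have "\<dots> = (\<Sum>x\<in>?D m. \<Sum>y\<in>?D (snd x). f (fst x) * (g (fst y) * h (snd y)))"
    by (rule sum.Sigma[OF fin(3,2), symmetric])
  also have "\<dots> = ps_times f (ps_times g h) m"
    unfolding ps_times_def by (simp add: sum_distrib_left case_prod_unfold)
  finally show "ps_times (ps_times f g) h m = ps_times f (ps_times g h) m" .
qed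

lemma lookup_monom_at_notin: "i \<notin> set js \<Longrightarrow> Poly_Mapping.lookup (monom_at js a) i = 0"
proof (induction js arbitrary: a)
  case (Cons j js)
  then show ?case by (cases a) (auto simp: monom_at_def lookup_add lookup_single)
qed (simp add: monom_at_def)

lemma lookup_monom_at:
  "distinct js \<Longrightarrow> length a = length js \<Longrightarrow> l < length js \<Longrightarrow>
    Poly_Mapping.lookup (monom_at js a) (js ! l) = a ! l"
proof (induction js arbitrary: a l)
  case (Cons j js)
  then obtain x b where a: "a = x # b" by (cases a) auto
  have *: "monom_at (j # js) (x # b) = Poly_Mapping.single j x + monom_at js b"
    by (simp add: monom_at_def)
  show ?case
  proof (cases l)
    case 0
    then show ?thesis using Cons.prems a by (simp add: * lookup_add lookup_monom_at_notin)
  next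
    case (Suc l')
    then have "j \<noteq> js ! l'" using Cons.prems by auto
    then show ?thesis using Cons Suc a by (simp add: * lookup_add lookup_single)
  qed
qed simp

lemma monom_at_inj:
  assumes "distinct js" "length a = length js" "length b = length js" "monom_at js a = monom_at js b"
  shows "a = b"
  using assms lookup_monom_at by (metis nth_equalityI)

lemma monom_at_surj:
  assumes "distinct js" "Poly_Mapping.keys m \<subseteq> set js"
  shows "m = monom_at js (map (Poly_Mapping.lookup m) js)"
proof (rule poly_mapping_eqI)
  fix i
  show "Poly_Mapping.lookup m i = Poly_Mapping.lookup (monom_at js (map (Poly_Mapping.lookup m) js)) i"
  proof (cases "i \<in> set js")
    case True
    then obtain l where "l < length js" "i = js ! l" by (metis in_set_conv_nth)
    then show ?thesis using assms lookup_monom_at[of js "map (Poly_Mapping.lookup m) js" l] by simp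
  next
    case False
    then show ?thesis using assms by (auto simp: lookup_monom_at_notin in_keys_iff)
  qed
qed

lemma monom_at_add:
  "length a = length js \<Longrightarrow> length b = length js \<Longrightarrow>
    monom_at js a + monom_at js b = monom_at js (map2 (+) a b)"
proof (induction js arbitrary: a b)
  case (Cons j js)
  then obtain x a' y b' where ab: "a = x # a'" "b = y # b'"
    by (metis length_Suc_conv)
  have "monom_at js a' + monom_at js b' = monom_at js (map2 (+) a' b')" using Cons ab by simp
  then show ?case unfolding ab by (simp add: monom_at_def single_add algebra_simps)
qed (simp add: monom_at_def)

lemma monom_at_weak:
  assumes "quasisymmetric f" "sorted_wrt (<) js" "sorted_wrt (<) ks"
    and "length js = length a" "length ks = length a"
  shows "f (monom_at js a) = f (monom_at ks a)"
proof -
  define nz where "nz = (\<lambda>js :: nat list. map fst (filter (\<lambda>(i, x). x \<noteq> 0) (zip js a)))"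
  define b where "b = filter (\<lambda>x. x \<noteq> 0) a"
  have len: "length (nz l) = length b" if "length l = length a" for l
    using that unfolding nz_def b_def by (induction l a rule: list_induct2) auto
  have at: "monom_at (nz l) b = monom_at l a" if "length l = length a" for l
    using that unfolding nz_def b_def by (induction l a rule: list_induct2) (auto simp: monom_at_def)
  have sub: "set (map fst (filter P (zip l a))) \<subseteq> set l" for l :: "nat list" and P a
    by (auto dest: set_zip_leftD)
  have sorted: "sorted_wrt (<) (nz l)" if "length l = length a" "sorted_wrt (<) l" for l
    using that unfolding nz_def
  proof (induction l a rule: list_induct2)
    case (Cons x xs y ys)
    then show ?case using sub[of _ xs ys] by fastforce
  qed simp
  have "b \<in> compositions" by (auto simp: b_def compositions_def)
  then have "f (monom_at (nz js) b) = f (monom_at (nz ks) b)"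
    using assms len sorted unfolding quasisymmetric_def by metis
  then show ?thesis using at assms by simp
qed

lemma quasisymmetric_times:
  assumes f: "quasisymmetric f" and g: "quasisymmetric g"
  shows "quasisymmetric (ps_times f g)"
  unfolding quasisymmetric_def
proof (intro ballI allI impI; elim conjE)
  fix \<alpha> js ks :: "nat list"
  assume *: "length js = length \<alpha>" "length ks = length \<alpha>" and s: "sorted_wrt (<) js" "sorted_wrt (<) ks"
  define W where "W = {(a, b). length a = length \<alpha> \<and> length b = length \<alpha> \<and> map2 (+) a b = \<alpha>}"
  have eq: "ps_times f g (monom_at l \<alpha>) = (\<Sum>(a, b)\<in>W. f (monom_at l a) * g (monom_at l b))"
    if l: "length l = length \<alpha>" "sorted_wrt (<) l" for l
  proof -
    have d: "distinct l" using l(2) strict_sorted_iff by blast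
    have "bij_betw (\<lambda>(a, b). (monom_at l a, monom_at l b)) W {(p, q). p + q = monom_at l \<alpha>}"
      unfolding bij_betw_def
    proof
      show "inj_on (\<lambda>(a, b). (monom_at l a, monom_at l b)) W"
      proof (rule inj_onI, clarify)
        fix a b a' b' assume "(a, b) \<in> W" "(a', b') \<in> W"
          and e: "monom_at l a = monom_at l a'" "monom_at l b = monom_at l b'"
        then have "length a = length l" "length b = length l" "length a' = length l" "length b' = length l"
          using l by (auto simp: W_def)
        then show "a = a' \<and> b = b'" using monom_at_inj[OF d] e by blast
      qed
      show "(\<lambda>(a, b). (monom_at l a, monom_at l b)) ` W = {(p, q). p + q = monom_at l \<alpha>}"
      proof safe
        fix a b assume "(a, b) \<in> W"
        then show "monom_at l a + monom_at l b = monom_at l \<alpha>" using l by (simp add: W_def monom_at_add)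
      next
        fix p q assume pq: "p + q = monom_at l \<alpha>"
        have le: "Poly_Mapping.lookup p i \<le> Poly_Mapping.lookup (monom_at l \<alpha>) i"
          "Poly_Mapping.lookup q i \<le> Poly_Mapping.lookup (monom_at l \<alpha>) i" for i
          by (simp_all flip: pq add: lookup_add)
        have k: "Poly_Mapping.keys p \<subseteq> set l" "Poly_Mapping.keys q \<subseteq> set l"
        proof -
          have "i \<in> set l" if "Poly_Mapping.lookup p i \<noteq> 0 \<or> Poly_Mapping.lookup q i \<noteq> 0" for i
            using that le[of i] lookup_monom_at_notin[of i l \<alpha>] by (cases "i \<in> set l") auto
          then show "Poly_Mapping.keys p \<subseteq> set l" "Poly_Mapping.keys q \<subseteq> set l"
            by (auto simp: in_keys_iff)
        qed
        define a where "a = map (Poly_Mapping.lookup p) l"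
        define b where "b = map (Poly_Mapping.lookup q) l"
        have p: "p = monom_at l a" "q = monom_at l b"
          unfolding a_def b_def by (rule monom_at_surj[OF d k(1)], rule monom_at_surj[OF d k(2)])
        have len: "length a = length l" "length b = length l" by (auto simp: a_def b_def)
        then have "monom_at l (map2 (+) a b) = monom_at l \<alpha>"
          using monom_at_add[of a l b] pq p by simp
        then have "map2 (+) a b = \<alpha>" using monom_at_inj[OF d] len l by simp
        then have "(a, b) \<in> W" using len l by (simp add: W_def)
        then show "(p, q) \<in> (\<lambda>(a, b). (monom_at l a, monom_at l b)) ` W"
          unfolding p by (rule rev_image_eqI) simp
      qed
    qed
    from sum.reindex_bij_betw[OF this, of "\<lambda>x. f (fst x) * g (snd x)", symmetric] show ?thesis
      unfolding ps_times_def case_prod_unfold fst_conv snd_conv .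
  qed
  have "(\<Sum>(a, b)\<in>W. f (monom_at js a) * g (monom_at js b)) = (\<Sum>(a, b)\<in>W. f (monom_at ks a) * g (monom_at ks b))"
  proof (rule sum.cong[OF refl], clarify)
    fix a b assume "(a, b) \<in> W"
    then show "f (monom_at js a) * g (monom_at js b) = f (monom_at ks a) * g (monom_at ks b)"
      using monom_at_weak[OF f s, of a] monom_at_weak[OF g s, of b] * by (simp add: W_def)
  qed
  then show "ps_times f g (monom_at js \<alpha>) = ps_times f g (monom_at ks \<alpha>)" using eq * s by simp
qed

lemma bounded_degree_times:
  assumes "bounded_degree f" "bounded_degree g"
  shows "bounded_degree (ps_times f g)"
proof -
  from assms obtain d e where d: "\<And>m. f m \<noteq> 0 \<Longrightarrow> mdegree m \<le> d" "\<And>m. g m \<noteq> 0 \<Longrightarrow> mdegree m \<le> e"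
    unfolding bounded_degree_def by blast
  have "mdegree m \<le> d + e" if "ps_times f g m \<noteq> 0" for m
  proof -
    have "\<not> (\<forall>x\<in>{(p, q). p + q = m}. (case x of (p, q) \<Rightarrow> f p * g q) = 0)"
      using that unfolding ps_times_def by (meson sum.neutral)
    then obtain p q where "p + q = m" "f p * g q \<noteq> 0"
      unfolding Ball_def by (auto simp del: mult_eq_0_iff)
    then show ?thesis using d(1)[of p] d(2)[of q] by (auto simp: mdegree_add)
  qed
  then show ?thesis unfolding bounded_degree_def by blast
qed

lemma bounded_degree_add:
  assumes "bounded_degree f" "bounded_degree g"
  shows "bounded_degree (\<lambda>m. f m + g m)"
proof -
  from assms obtain d e where "\<And>m. f m \<noteq> 0 \<Longrightarrow> mdegree m \<le> d" "\<And>m. g m \<noteq> 0 \<Longrightarrow> mdegree m \<le> e"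
    unfolding bounded_degree_def by blast
  then have "mdegree m \<le> max d e" if "f m + g m \<noteq> 0" for m
    using that by (cases "f m = 0") (auto simp: le_max_iff_disj)
  then show ?thesis unfolding bounded_degree_def by blast
qed

lemma monom_at_eq_0_iff: "length js = length a \<Longrightarrow> monom_at js a = 0 \<longleftrightarrow> set a \<subseteq> {0}"
proof (induction js a rule: list_induct2)
  case (Cons x xs y ys)
  have *: "monom_at (x # xs) (y # ys) = Poly_Mapping.single x y + monom_at xs ys"
    by (simp add: monom_at_def)
  have "p + q = 0 \<longleftrightarrow> p = 0 \<and> q = 0" for p q :: monom
    by (auto simp: poly_mapping_eq_iff fun_eq_iff lookup_add)
  moreover have "Poly_Mapping.single x y = 0 \<longleftrightarrow> y = 0"
    by (metis lookup_single_eq lookup_zero single_zero)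
  ultimately show ?case using Cons by (simp add: *)
qed (simp add: monom_at_def)

typedef qsym = "{f. bounded_degree f \<and> quasisymmetric f}"
  morphisms coeff_of Abs_qsym
  by (rule exI[of _ "\<lambda>_. 0"]) (simp add: bounded_degree_def quasisymmetric_def)

setup_lifting type_definition_qsym

instantiation qsym :: comm_ring_1
begin

lift_definition zero_qsym :: qsym is "\<lambda>_. 0"
  by (simp add: bounded_degree_def quasisymmetric_def)

lift_definition one_qsym :: qsym is ps_one
proof
  show "bounded_degree ps_one"
    by (auto simp: bounded_degree_def ps_one_def mdegree_def)
  show "quasisymmetric ps_one"
    by (simp add: quasisymmetric_def ps_one_def monom_at_eq_0_iff)
qed

lift_definition plus_qsym :: "qsym \<Rightarrow> qsym \<Rightarrow> qsym" is "\<lambda>f g m. f m + g m"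
proof safe
  fix f g :: "monom \<Rightarrow> rat"
  assume "quasisymmetric f" "quasisymmetric g"
  then show "quasisymmetric (\<lambda>m. f m + g m)" unfolding quasisymmetric_def by metis
qed (rule bounded_degree_add)

lift_definition uminus_qsym :: "qsym \<Rightarrow> qsym" is "\<lambda>f m. - f m"
  by (simp add: bounded_degree_def quasisymmetric_def)

lift_definition minus_qsym :: "qsym \<Rightarrow> qsym \<Rightarrow> qsym" is "\<lambda>f g m. f m - g m"
proof safe
  fix f g :: "monom \<Rightarrow> rat"
  assume "bounded_degree f" "bounded_degree g"
  moreover from this have "bounded_degree (\<lambda>m. - g m)" by (simp add: bounded_degree_def)
  ultimately show "bounded_degree (\<lambda>m. f m - g m)" using bounded_degree_add by fastforce
next
  fix f g :: "monom \<Rightarrow> rat"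
  assume "quasisymmetric f" "quasisymmetric g"
  then show "quasisymmetric (\<lambda>m. f m - g m)" unfolding quasisymmetric_def by metis
qed

lift_definition times_qsym :: "qsym \<Rightarrow> qsym \<Rightarrow> qsym" is ps_times
  by (simp add: bounded_degree_times quasisymmetric_times)

instance
proof
  fix a b c :: qsym
  show "a * b * c = a * (b * c)" by transfer (rule ps_times_assoc)
  show "a * b = b * a" by transfer (rule ps_times_commute)
  show "1 * a = a" by transfer (rule ps_times_one)
  show "(a + b) * c = a * c + b * c"
    by transfer (simp add: ps_times_def fun_eq_iff algebra_simps sum.distrib case_prod_unfold)
  show "(0 :: qsym) \<noteq> 1" by transfer (auto simp: fun_eq_iff ps_one_def)
  show "a + b + c = a + (b + c)" "a + b = b + a" "0 + a = a" "- a + a = 0" "a - b = a + - b"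
    by (transfer, simp add: fun_eq_iff)+
qed

end

lift_definition qscale :: "rat \<Rightarrow> qsym \<Rightarrow> qsym" is "\<lambda>c f m. c * f m"
proof safe
  fix c and f :: "monom \<Rightarrow> rat"
  assume "bounded_degree f"
  then show "bounded_degree (\<lambda>m. c * f m)" by (simp add: bounded_degree_def) blast
next
  fix c and f :: "monom \<Rightarrow> rat"
  assume "quasisymmetric f"
  then show "quasisymmetric (\<lambda>m. c * f m)" unfolding quasisymmetric_def by metis
qed

global_interpretation qsym: vector_space qscale
  by unfold_locales (transfer; simp add: fun_eq_iff algebra_simps)+

lemma mdegree_single [simp]: "mdegree (Poly_Mapping.single i a) = a"
  by (simp add: mdegree_def)

lemma mdegree_monom_at: "length js = length \<alpha> \<Longrightarrow> mdegree (monom_at js \<alpha>) = sum_list \<alpha>"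
proof (induction js \<alpha> rule: list_induct2)
  case Nil
  then show ?case by (simp add: monom_at_def mdegree_def)
next
  case (Cons x xs y ys)
  then show ?case by (simp add: monom_at_def mdegree_add)
qed

lemma keys_monom_at:
  assumes "length js = length \<alpha>" "distinct js" "\<alpha> \<in> compositions"
  shows "Poly_Mapping.keys (monom_at js \<alpha>) = set js"
proof safe
  fix i assume "i \<in> Poly_Mapping.keys (monom_at js \<alpha>)"
  then show "i \<in> set js" using lookup_monom_at_notin[of i js \<alpha>] by (cases "i \<in> set js") (simp_all add: in_keys_iff)
next
  fix i assume "i \<in> set js"
  then obtain l where l: "l < length js" "i = js ! l" by (metis in_set_conv_nth)
  have "\<alpha> ! l \<noteq> 0" using l assms by (metis nth_mem compositions_def mem_Collect_eq)
  then show "i \<in> Poly_Mapping.keys (monom_at js \<alpha>)"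
    using lookup_monom_at[of js \<alpha> l] l assms by (simp add: in_keys_iff)
qed

lemma monom_at_eq_iff:
  assumes "length js = length \<alpha>" "length ks = length \<beta>" "\<alpha> \<in> compositions" "\<beta> \<in> compositions"
    and "sorted_wrt (<) js" "sorted_wrt (<) ks"
  shows "monom_at js \<alpha> = monom_at ks \<beta> \<longleftrightarrow> js = ks \<and> \<alpha> = \<beta>"
proof
  assume eq: "monom_at js \<alpha> = monom_at ks \<beta>"
  have d: "distinct js" "distinct ks" "sorted js" "sorted ks" using assms(5,6) by (auto simp: strict_sorted_iff)
  have "set js = set ks"
    using keys_monom_at[OF assms(1) d(1) assms(3)] keys_monom_at[OF assms(2) d(2) assms(4)]
    unfolding eq by blast
  then have "js = ks" using d by (intro sorted_distinct_set_unique)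
  moreover have "\<alpha> = \<beta>"
  proof (rule monom_at_inj[OF d(1)])
    show "monom_at js \<alpha> = monom_at js \<beta>" using eq unfolding \<open>js = ks\<close> .
  qed (use assms \<open>js = ks\<close> in simp_all)
  ultimately show "js = ks \<and> \<alpha> = \<beta>" ..
qed simp

text \<open>For a composition \<open>\<alpha>\<close>, the monomials \<open>monom_at js \<alpha>\<close> with strictly increasing \<open>js\<close> are
  pairwise distinct, so every coefficient of their sum is 0 or 1.
  Lists with a zero part are not compositions and are mapped to 0.\<close>

lift_definition qsym_M :: "nat list \<Rightarrow> qsym" is
  "\<lambda>\<alpha> m. if \<alpha> \<in> compositions \<and> (\<exists>js. length js = length \<alpha> \<and> sorted_wrt (<) js \<and> m = monom_at js \<alpha>)
         then 1 else 0"
proof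
  fix \<alpha> :: "nat list"
  let ?f = "\<lambda>m. if \<alpha> \<in> compositions \<and> (\<exists>js. length js = length \<alpha> \<and> sorted_wrt (<) js \<and> m = monom_at js \<alpha>)
         then 1 else 0 :: rat"
  have "mdegree m \<le> sum_list \<alpha>" if "?f m \<noteq> 0" for m
  proof -
    from that obtain js where "length js = length \<alpha>" "m = monom_at js \<alpha>" by (auto split: if_splits)
    then show ?thesis by (simp add: mdegree_monom_at)
  qed
  then show "bounded_degree ?f" unfolding bounded_degree_def by blast
  have "?f (monom_at ks \<beta>) = (if \<beta> = \<alpha> then 1 else 0)"
    if "\<beta> \<in> compositions" "length ks = length \<beta>" "sorted_wrt (<) ks" for ks \<beta>
  proof (cases "\<beta> = \<alpha>")
    case True
    then show ?thesis using that by auto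
  next
    case False
    then have "\<not> (\<alpha> \<in> compositions \<and> (\<exists>js. length js = length \<alpha> \<and> sorted_wrt (<) js \<and> monom_at ks \<beta> = monom_at js \<alpha>))"
      using that monom_at_eq_iff by blast
    then show ?thesis using False by (simp only: if_False)
  qed
  note eq = this
  show "quasisymmetric ?f"
    unfolding quasisymmetric_def
  proof (intro ballI allI impI; elim conjE)
    fix \<beta> js ks :: "nat list"
    assume *: "\<beta> \<in> compositions" "length js = length \<beta>" "length ks = length \<beta>"
      and s: "sorted_wrt (<) js" "sorted_wrt (<) ks"
    show "?f (monom_at js \<beta>) = ?f (monom_at ks \<beta>)"
      unfolding eq[OF *(1,2) s(1)] eq[OF *(1,3) s(2)] ..
  qed
qed

definition qsym_F :: "nat list \<Rightarrow> qsym" where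
  "qsym_F \<alpha> = (\<Sum>\<beta> | \<beta> \<in> compositions \<and> refines \<beta> \<alpha>. qsym_M \<beta>)"

definition qsym_deg :: "nat \<Rightarrow> qsym set" where
  "qsym_deg n = qsym.span (qsym_M ` {\<alpha> \<in> compositions. sum_list \<alpha> = n})"

text \<open>The common coefficient of the monomials of \<open>M\<^sub>\<alpha>\<close> in \<open>f\<close>; it is also the coefficient of
  \<open>f\<close> at the basis element \<open>M\<^sub>\<alpha>\<close>, see \<open>qsym_M_expansion\<close>.\<close>

definition qcoeff :: "qsym \<Rightarrow> nat list \<Rightarrow> rat" where
  "qcoeff f \<alpha> = coeff_of f (monom_at [0..<length \<alpha>] \<alpha>)"

lemma qcoeff_eqI:
  assumes "\<And>\<alpha>. \<alpha> \<in> compositions \<Longrightarrow> qcoeff f \<alpha> = qcoeff g \<alpha>"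
  shows "f = g"
proof -
  have "coeff_of f m = coeff_of g m" for m
  proof -
    define js where "js = sorted_list_of_set (Poly_Mapping.keys m)"
    define \<alpha> where "\<alpha> = map (Poly_Mapping.lookup m) js"
    have js: "sorted_wrt (<) js" "distinct js" "set js = Poly_Mapping.keys m"
      by (simp_all add: js_def)
    have m: "m = monom_at js \<alpha>"
      unfolding \<alpha>_def by (rule monom_at_surj) (simp_all add: js)
    have \<alpha>: "\<alpha> \<in> compositions" "length js = length \<alpha>"
      using js by (auto simp: compositions_def \<alpha>_def in_keys_iff)
    have "coeff_of h m = qcoeff h \<alpha>" for h
    proof -
      have "quasisymmetric (coeff_of h)" using coeff_of by blast
      then have "coeff_of h (monom_at js \<alpha>) = coeff_of h (monom_at [0..<length \<alpha>] \<alpha>)"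
        using \<alpha> js by (intro monom_at_weak) (simp_all add: sorted_wrt_upt)
      then show ?thesis unfolding qcoeff_def m .
    qed
    then show ?thesis using assms[OF \<alpha>(1)] by simp
  qed
  then show ?thesis by (simp add: coeff_of_inject[symmetric] fun_eq_iff)
qed

lemma qcoeff_simps [simp]:
  "qcoeff 0 \<alpha> = 0" "qcoeff (f + g) \<alpha> = qcoeff f \<alpha> + qcoeff g \<alpha>"
  "qcoeff (f - g) \<alpha> = qcoeff f \<alpha> - qcoeff g \<alpha>" "qcoeff (qscale c f) \<alpha> = c * qcoeff f \<alpha>"
  unfolding qcoeff_def by (transfer, simp)+

lemma qcoeff_sum: "qcoeff (\<Sum>x\<in>A. f x) \<alpha> = (\<Sum>x\<in>A. qcoeff (f x) \<alpha>)"
  by (induction A rule: infinite_finite_induct) auto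

lemma qcoeff_M:
  assumes "\<alpha> \<in> compositions" "\<beta> \<in> compositions"
  shows "qcoeff (qsym_M \<beta>) \<alpha> = (if \<alpha> = \<beta> then 1 else 0)"
proof -
  have "(\<exists>js. length js = length \<beta> \<and> sorted_wrt (<) js \<and> monom_at [0..<length \<alpha>] \<alpha> = monom_at js \<beta>)
      \<longleftrightarrow> \<alpha> = \<beta>"
    using assms monom_at_eq_iff[of "[0..<length \<alpha>]" \<alpha> _ \<beta>] by (auto intro: exI[of _ "[0..<length \<alpha>]"])
  then show ?thesis unfolding qcoeff_def qsym_M.rep_eq using assms by simp
qed

lemma finite_qcoeff: "finite {\<alpha> \<in> compositions. qcoeff f \<alpha> \<noteq> 0}"
proof -
  obtain d where d: "\<And>m. coeff_of f m \<noteq> 0 \<Longrightarrow> mdegree m \<le> d"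
    using coeff_of[of f] unfolding bounded_degree_def by blast
  have "sum_list \<alpha> \<le> d" if "qcoeff f \<alpha> \<noteq> 0" for \<alpha>
    using d that unfolding qcoeff_def by (metis mdegree_monom_at length_upt diff_zero)
  then have "{\<alpha> \<in> compositions. qcoeff f \<alpha> \<noteq> 0} \<subseteq> (\<Union>n\<le>d. {\<alpha> \<in> compositions. sum_list \<alpha> = n})"
    by auto
  then show ?thesis using finite_compositions finite_subset by (metis (no_types, lifting) finite_UN finite_atMost)
qed

lemma qsym_M_expansion:
  "f = (\<Sum>\<alpha> | \<alpha> \<in> compositions \<and> qcoeff f \<alpha> \<noteq> 0. qscale (qcoeff f \<alpha>) (qsym_M \<alpha>))"
proof (rule qcoeff_eqI)
  fix \<beta> assume \<beta>: "\<beta> \<in> compositions"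
  have "(\<Sum>\<alpha> | \<alpha> \<in> compositions \<and> qcoeff f \<alpha> \<noteq> 0. qcoeff f \<alpha> * qcoeff (qsym_M \<alpha>) \<beta>)
    = (\<Sum>\<alpha> | \<alpha> \<in> compositions \<and> qcoeff f \<alpha> \<noteq> 0. if \<beta> = \<alpha> then qcoeff f \<alpha> else 0)"
    using \<beta> by (intro sum.cong) (auto simp: qcoeff_M)
  also have "\<dots> = qcoeff f \<beta>" using finite_qcoeff[of f] \<beta> by (simp add: sum.delta)
  finally show "qcoeff f \<beta> = qcoeff (\<Sum>\<alpha> | \<alpha> \<in> compositions \<and> qcoeff f \<alpha> \<noteq> 0. qscale (qcoeff f \<alpha>) (qsym_M \<alpha>)) \<beta>"
    by (simp add: qcoeff_sum)
qed

lemma qcoeff_F: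
  assumes "\<beta> \<in> compositions"
  shows "qcoeff (qsym_F \<alpha>) \<beta> = (if refines \<beta> \<alpha> then 1 else 0)"
proof -
  have "qcoeff (qsym_F \<alpha>) \<beta> = (\<Sum>\<gamma> | \<gamma> \<in> compositions \<and> refines \<gamma> \<alpha>. if \<beta> = \<gamma> then 1 else 0)"
    unfolding qsym_F_def qcoeff_sum using assms by (intro sum.cong) (auto simp: qcoeff_M)
  then show ?thesis using finite_refines[of \<alpha>] assms by (simp add: sum.delta)
qed

lemma inj_on_qsym_F: "inj_on qsym_F compositions"
proof (rule inj_onI)
  fix \<alpha> \<beta> assume *: "\<alpha> \<in> compositions" "\<beta> \<in> compositions" "qsym_F \<alpha> = qsym_F \<beta>"
  have r: "refines \<alpha> \<alpha>" "refines \<beta> \<beta>" using * by (auto simp: compositions_def refines_refl)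
  then have "refines \<alpha> \<beta>" "refines \<beta> \<alpha>"
    using * qcoeff_F[of \<alpha> \<alpha>] qcoeff_F[of \<alpha> \<beta>] qcoeff_F[of \<beta> \<alpha>] qcoeff_F[of \<beta> \<beta>]
    by (auto split: if_splits)
  then show "\<alpha> = \<beta>" using refines_length by (metis le_antisym)
qed

lemma independent_qsym_F: "qsym.independent (qsym_F ` compositions)"
  unfolding qsym.independent_explicit_finite_subsets
proof (intro allI impI ballI)
  fix S u v
  assume S: "S \<subseteq> qsym_F ` compositions" "finite S" "(\<Sum>v\<in>S. qscale (u v) v) = 0" and v: "v \<in> S"
  obtain A where A: "A \<subseteq> compositions" "S = qsym_F ` A" using S(1) by (meson subset_imageE)
  have inj: "inj_on qsym_F A" using inj_on_qsym_F A(1) inj_on_subset by blast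
  have fin: "finite A" using S(2) A(2) inj finite_imageD by blast
  have zero: "(\<Sum>\<alpha>\<in>A. qscale (u (qsym_F \<alpha>)) (qsym_F \<alpha>)) = 0"
    using S(3) A(2) sum.reindex[OF inj, of "\<lambda>v. qscale (u v) v"] by simp
  have "\<alpha> \<in> A \<Longrightarrow> u (qsym_F \<alpha>) = 0" for \<alpha>
  proof (induction "length \<alpha>" arbitrary: \<alpha> rule: less_induct)
    case less
    have "0 = qcoeff (\<Sum>\<beta>\<in>A. qscale (u (qsym_F \<beta>)) (qsym_F \<beta>)) \<alpha>" by (simp add: zero)
    also have "\<dots> = (\<Sum>\<beta>\<in>A. u (qsym_F \<beta>) * qcoeff (qsym_F \<beta>) \<alpha>)" by (simp add: qcoeff_sum)
    also have "\<dots> = (\<Sum>\<beta>\<in>{\<alpha>}. u (qsym_F \<beta>) * qcoeff (qsym_F \<beta>) \<alpha>)"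
    proof (rule sum.mono_neutral_right[OF fin])
      show "\<forall>\<beta>\<in>A - {\<alpha>}. u (qsym_F \<beta>) * qcoeff (qsym_F \<beta>) \<alpha> = 0"
      proof
        fix \<beta> assume \<beta>: "\<beta> \<in> A - {\<alpha>}"
        show "u (qsym_F \<beta>) * qcoeff (qsym_F \<beta>) \<alpha> = 0"
        proof (cases "refines \<alpha> \<beta>")
          case True
          then have "length \<beta> < length \<alpha>" using refines_length[OF True] \<beta> by force
          then show ?thesis using less.hyps \<beta> by simp
        next
          case False
          then show ?thesis using qcoeff_F[of \<alpha> \<beta>] A(1) less.prems by auto
        qed
      qed
    qed (use less.prems in simp)
    finally have "0 = u (qsym_F \<alpha>) * qcoeff (qsym_F \<alpha>) \<alpha>" by simp
    moreover have "qcoeff (qsym_F \<alpha>) \<alpha> = 1"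
      using A(1) less.prems by (auto simp: qcoeff_F compositions_def refines_refl)
    ultimately show ?case by simp
  qed
  then show "u v = 0" using v A(2) by blast
qed

lemma span_qsym_F: "qsym.span (qsym_F ` compositions) = UNIV"
proof -
  have M: "\<alpha> \<in> compositions \<Longrightarrow> qsym_M \<alpha> \<in> qsym.span (qsym_F ` compositions)" for \<alpha>
  proof (induction "sum_list \<alpha> - length \<alpha>" arbitrary: \<alpha> rule: less_induct)
    case less
    let ?R = "{\<beta> \<in> compositions. refines \<beta> \<alpha>}"
    have "\<alpha> \<in> ?R" using less.prems by (auto simp: compositions_def refines_refl)
    then have "qsym_F \<alpha> = qsym_M \<alpha> + (\<Sum>\<beta>\<in>?R - {\<alpha>}. qsym_M \<beta>)"
      unfolding qsym_F_def using finite_refines by (simp add: sum.remove)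
    moreover have "(\<Sum>\<beta>\<in>?R - {\<alpha>}. qsym_M \<beta>) \<in> qsym.span (qsym_F ` compositions)"
    proof (rule qsym.span_sum)
      fix \<beta> assume \<beta>: "\<beta> \<in> ?R - {\<alpha>}"
      then have "length \<alpha> < length \<beta>" "sum_list \<beta> = sum_list \<alpha>" "length \<beta> \<le> sum_list \<beta>"
        using refines_length[of \<beta> \<alpha>] refines_sum[of \<beta> \<alpha>] length_le_sum_list[of \<beta>]
        by (auto simp: compositions_def order.strict_iff_order)
      then show "qsym_M \<beta> \<in> qsym.span (qsym_F ` compositions)"
        using less.hyps[of \<beta>] \<beta> by auto
    qed
    moreover have "qsym_F \<alpha> \<in> qsym.span (qsym_F ` compositions)"
      using less.prems by (intro qsym.span_base imageI)
    ultimately show ?case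
      using qsym.span_diff[of "qsym_F \<alpha>" _ "\<Sum>\<beta>\<in>?R - {\<alpha>}. qsym_M \<beta>"] by simp
  qed
  have "f \<in> qsym.span (qsym_F ` compositions)" for f
  proof -
    have "(\<Sum>\<alpha> | \<alpha> \<in> compositions \<and> qcoeff f \<alpha> \<noteq> 0. qscale (qcoeff f \<alpha>) (qsym_M \<alpha>))
        \<in> qsym.span (qsym_F ` compositions)"
      using M by (intro qsym.span_sum qsym.span_scale) auto
    then show ?thesis unfolding qsym_M_expansion[symmetric] .
  qed
  then show ?thesis by blast
qed

lemma ex1_qsym_F_compl:
  "\<exists>!\<Psi>. Vector_Spaces.linear qscale qscale \<Psi> \<and>
     (\<forall>\<alpha>\<in>compositions. \<Psi> (qsym_F \<alpha>) = qsym_F (comp_compl \<alpha>))"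
proof -
  interpret vector_space_pair qscale qscale ..
  have "\<exists>g. Vector_Spaces.linear qscale qscale g \<and>
      (\<forall>x\<in>qsym_F ` compositions. g x = qsym_F (comp_compl (the_inv_into compositions qsym_F x)))"
    by (rule linear_independent_extend[OF independent_qsym_F])
  then obtain g where "Vector_Spaces.linear qscale qscale g"
    "\<forall>\<alpha>\<in>compositions. g (qsym_F \<alpha>) = qsym_F (comp_compl \<alpha>)"
    by (auto simp: the_inv_into_f_f[OF inj_on_qsym_F])
  moreover have "f = g" if "Vector_Spaces.linear qscale qscale f" "Vector_Spaces.linear qscale qscale g"
    "\<forall>\<alpha>\<in>compositions. f (qsym_F \<alpha>) = qsym_F (comp_compl \<alpha>)"
    "\<forall>\<alpha>\<in>compositions. g (qsym_F \<alpha>) = qsym_F (comp_compl \<alpha>)" for f g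
  proof
    fix x
    show "f x = g x"
      by (rule linear_eq_on_span[OF that(1,2), of "qsym_F ` compositions"]) (use that span_qsym_F in auto)
  qed
  ultimately show ?thesis by blast
qed

text \<open>The quotient of the free vector space on pairs by the bilinearity relations.\<close>

definition fscale :: "rat \<Rightarrow> (qsym \<times> qsym \<Rightarrow>\<^sub>0 rat) \<Rightarrow> (qsym \<times> qsym \<Rightarrow>\<^sub>0 rat)" where
  "fscale c t = Poly_Mapping.map ((*) c) t"

lemma lookup_fscale: "Poly_Mapping.lookup (fscale c t) p = c * Poly_Mapping.lookup t p"
  unfolding fscale_def by (simp add: Poly_Mapping.map.rep_eq when_def)

global_interpretation free: vector_space fscale
  by unfold_locales (simp_all add: poly_mapping_eq_iff fun_eq_iff lookup_fscale lookup_add algebra_simps)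

abbreviation free_pair :: "qsym \<Rightarrow> qsym \<Rightarrow> (qsym \<times> qsym \<Rightarrow>\<^sub>0 rat)" where
  "free_pair f g \<equiv> Poly_Mapping.single (f, g) 1"

definition tensor_relations :: "(qsym \<times> qsym \<Rightarrow>\<^sub>0 rat) set" where
  "tensor_relations =
     {free_pair (f + f') g - free_pair f g - free_pair f' g | f f' g. True} \<union>
     {free_pair f (g + g') - free_pair f g - free_pair f g' | f g g'. True} \<union>
     {free_pair (qscale c f) g - fscale c (free_pair f g) | c f g. True} \<union>
     {free_pair f (qscale c g) - fscale c (free_pair f g) | c f g. True}"

definition tensor_rel :: "(qsym \<times> qsym \<Rightarrow>\<^sub>0 rat) \<Rightarrow> (qsym \<times> qsym \<Rightarrow>\<^sub>0 rat) \<Rightarrow> bool" where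
  "tensor_rel s t \<longleftrightarrow> s - t \<in> free.span tensor_relations"

lemma equivp_tensor_rel: "equivp tensor_rel"
proof (rule equivpI)
  show "reflp tensor_rel" by (rule reflpI) (simp add: tensor_rel_def free.span_zero)
  show "symp tensor_rel"
  proof (rule sympI)
    fix s t assume "tensor_rel s t"
    then show "tensor_rel t s" using free.span_neg[of "s - t"] by (simp add: tensor_rel_def)
  qed
  show "transp tensor_rel"
  proof (rule transpI)
    fix s t u assume "tensor_rel s t" "tensor_rel t u"
    then show "tensor_rel s u" using free.span_add[of "s - t" _ "t - u"] by (simp add: tensor_rel_def)
  qed
qed

quotient_type qsym_tensor = "qsym \<times> qsym \<Rightarrow>\<^sub>0 rat" / tensor_rel
  by (rule equivp_tensor_rel)

instantiation qsym_tensor :: ab_group_add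
begin

lift_definition zero_qsym_tensor :: qsym_tensor is 0 .

lift_definition plus_qsym_tensor :: "qsym_tensor \<Rightarrow> qsym_tensor \<Rightarrow> qsym_tensor" is "(+)"
proof -
  fix s s' t t' assume "tensor_rel s s'" "tensor_rel t t'"
  then have "(s - s') + (t - t') \<in> free.span tensor_relations"
    unfolding tensor_rel_def by (rule free.span_add)
  then show "tensor_rel (s + t) (s' + t')" by (simp add: tensor_rel_def algebra_simps)
qed

lift_definition uminus_qsym_tensor :: "qsym_tensor \<Rightarrow> qsym_tensor" is uminus
proof -
  fix s s' assume "tensor_rel s s'"
  then have "- (s - s') \<in> free.span tensor_relations"
    unfolding tensor_rel_def by (rule free.span_neg)
  then show "tensor_rel (- s) (- s')" by (simp add: tensor_rel_def)
qed

lift_definition minus_qsym_tensor :: "qsym_tensor \<Rightarrow> qsym_tensor \<Rightarrow> qsym_tensor" is "(-)"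
proof -
  fix s s' t t' assume "tensor_rel s s'" "tensor_rel t t'"
  then have "(s - s') - (t - t') \<in> free.span tensor_relations"
    unfolding tensor_rel_def by (rule free.span_diff)
  then show "tensor_rel (s - t) (s' - t')" by (simp add: tensor_rel_def algebra_simps)
qed

instance
proof
  have refl: "s = t \<Longrightarrow> tensor_rel s t" for s t using equivp_tensor_rel by (simp add: equivp_reflp)
  fix a b c :: qsym_tensor
  show "a + b + c = a + (b + c)" "a + b = b + a" "0 + a = a" "- a + a = 0" "a - b = a + - b"
    by (transfer, rule refl, simp)+
qed

end

lift_definition tscale :: "rat \<Rightarrow> qsym_tensor \<Rightarrow> qsym_tensor" is fscale
proof -
  fix c s s' assume "tensor_rel s s'"
  then have "fscale c (s - s') \<in> free.span tensor_relations"
    unfolding tensor_rel_def by (rule free.span_scale)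
  then show "tensor_rel (fscale c s) (fscale c s')"
    by (simp add: tensor_rel_def free.scale_right_diff_distrib)
qed

global_interpretation tensor: vector_space tscale
proof
  have refl: "s = t \<Longrightarrow> tensor_rel s t" for s t using equivp_tensor_rel by (simp add: equivp_reflp)
  fix a b x y
  show "tscale a (x + y) = tscale a x + tscale a y"
    by (transfer, rule refl) (rule free.scale_right_distrib)
  show "tscale (a + b) x = tscale a x + tscale b x"
    by (transfer, rule refl) (rule free.scale_left_distrib)
  show "tscale a (tscale b x) = tscale (a * b) x"
    by (transfer, rule refl) (rule free.scale_scale)
  show "tscale 1 x = x"
    by (transfer, rule refl) (rule free.scale_one)
qed

lift_definition tensor :: "qsym \<Rightarrow> qsym \<Rightarrow> qsym_tensor" is free_pair .

lemma tensor_bilinear: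
  "tensor (f + f') g = tensor f g + tensor f' g"
  "tensor f (g + g') = tensor f g + tensor f g'"
  "tensor (qscale c f) g = tscale c (tensor f g)"
  "tensor f (qscale c g) = tscale c (tensor f g)"
proof -
  have "free_pair (f + f') g - free_pair f g - free_pair f' g \<in> free.span tensor_relations"
    by (rule free.span_base, unfold tensor_relations_def Un_iff mem_Collect_eq,
        rule disjI1, rule disjI1, rule disjI1) ((rule exI)+, rule conjI, rule refl, rule TrueI)
  then show "tensor (f + f') g = tensor f g + tensor f' g"
    unfolding tensor.abs_eq plus_qsym_tensor.abs_eq qsym_tensor.abs_eq_iff tensor_rel_def diff_diff_eq .
  have "free_pair f (g + g') - free_pair f g - free_pair f g' \<in> free.span tensor_relations"
    by (rule free.span_base, unfold tensor_relations_def Un_iff mem_Collect_eq,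
        rule disjI1, rule disjI1, rule disjI2) ((rule exI)+, rule conjI, rule refl, rule TrueI)
  then show "tensor f (g + g') = tensor f g + tensor f g'"
    unfolding tensor.abs_eq plus_qsym_tensor.abs_eq qsym_tensor.abs_eq_iff tensor_rel_def diff_diff_eq .
  have "free_pair (qscale c f) g - fscale c (free_pair f g) \<in> free.span tensor_relations"
    by (rule free.span_base, unfold tensor_relations_def Un_iff mem_Collect_eq,
        rule disjI1, rule disjI2) ((rule exI)+, rule conjI, rule refl, rule TrueI)
  then show "tensor (qscale c f) g = tscale c (tensor f g)"
    unfolding tensor.abs_eq tscale.abs_eq qsym_tensor.abs_eq_iff tensor_rel_def .
  have "free_pair f (qscale c g) - fscale c (free_pair f g) \<in> free.span tensor_relations"
    by (rule free.span_base, unfold tensor_relations_def Un_iff mem_Collect_eq,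
        rule disjI2) ((rule exI)+, rule conjI, rule refl, rule TrueI)
  then show "tensor f (qscale c g) = tscale c (tensor f g)"
    unfolding tensor.abs_eq tscale.abs_eq qsym_tensor.abs_eq_iff tensor_rel_def .
qed

text \<open>The linear map on the tensor square induced by a bilinear map \<open>B\<close> into a vector space with
  scaling \<open>s\<close>; for bilinear \<open>B\<close> the choice of the representative is irrelevant.\<close>

definition free_lift :: "(rat \<Rightarrow> 'b \<Rightarrow> 'b) \<Rightarrow> (qsym \<Rightarrow> qsym \<Rightarrow> 'b) \<Rightarrow> (qsym \<times> qsym \<Rightarrow>\<^sub>0 rat) \<Rightarrow> 'b :: ab_group_add" where
  "free_lift s B t = (\<Sum>(f, g)\<in>Poly_Mapping.keys t. s (Poly_Mapping.lookup t (f, g)) (B f g))"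

definition tensor_lift :: "(rat \<Rightarrow> 'b \<Rightarrow> 'b) \<Rightarrow> (qsym \<Rightarrow> qsym \<Rightarrow> 'b) \<Rightarrow> qsym_tensor \<Rightarrow> 'b :: ab_group_add" where
  "tensor_lift s B T = free_lift s B (rep_qsym_tensor T)"

lemma linear_free_lift:
  assumes "vector_space s"
  shows "Vector_Spaces.linear fscale s (free_lift s B)"
proof -
  interpret vector_space s by fact
  have sup: "free_lift s B t = (\<Sum>p\<in>K. s (Poly_Mapping.lookup t p) (B (fst p) (snd p)))"
    if "finite K" "Poly_Mapping.keys t \<subseteq> K" for t K
    unfolding free_lift_def case_prod_unfold prod.collapse using that
    by (intro sum.mono_neutral_left) (auto simp: in_keys_iff)
  show ?thesis
  proof (intro Vector_Spaces.linear.intro assms free.vector_space_axioms module_hom.intro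
      free.module_axioms module_axioms module_hom_axioms.intro)
    fix t u :: "qsym \<times> qsym \<Rightarrow>\<^sub>0 rat"
    let ?K = "Poly_Mapping.keys t \<union> Poly_Mapping.keys u"
    have K: "finite ?K" "Poly_Mapping.keys t \<subseteq> ?K" "Poly_Mapping.keys u \<subseteq> ?K" "Poly_Mapping.keys (t + u) \<subseteq> ?K"
      using Poly_Mapping.keys_add[of t u] by auto
    show "free_lift s B (t + u) = free_lift s B t + free_lift s B u"
      unfolding sup[OF K(1,2)] sup[OF K(1,3)] sup[OF K(1,4)]
      by (simp add: lookup_add scale_left_distrib sum.distrib)
  next
    fix c and t :: "qsym \<times> qsym \<Rightarrow>\<^sub>0 rat"
    have K: "finite (Poly_Mapping.keys t)" "Poly_Mapping.keys t \<subseteq> Poly_Mapping.keys t"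
      "Poly_Mapping.keys (fscale c t) \<subseteq> Poly_Mapping.keys t"
      by (auto simp: in_keys_iff lookup_fscale)
    show "free_lift s B (fscale c t) = s c (free_lift s B t)"
      unfolding sup[OF K(1,2)] sup[OF K(1,3)] by (simp add: lookup_fscale scale_sum_right)
  qed
qed

lemma free_lift_pair:
  assumes "vector_space s" shows "free_lift s B (free_pair f g) = B f g"
proof -
  interpret vector_space s by fact
  show ?thesis unfolding free_lift_def by simp
qed

context
  fixes s :: "rat \<Rightarrow> 'b \<Rightarrow> 'b :: ab_group_add" and B :: "qsym \<Rightarrow> qsym \<Rightarrow> 'b"
  assumes B1: "\<And>g. Vector_Spaces.linear qscale s (\<lambda>f. B f g)"
    and B2: "\<And>f. Vector_Spaces.linear qscale s (B f)"
begin

lemma free_lift_cong: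
  assumes "tensor_rel t u" shows "free_lift s B t = free_lift s B u"
proof -
  interpret b: Vector_Spaces.linear qscale s "B f" for f by (rule B2)
  interpret a: Vector_Spaces.linear qscale s "\<lambda>f. B f g" for g by (rule B1)
  have vs: "vector_space s" by (rule b.vs2.vector_space_axioms)
  interpret l: Vector_Spaces.linear fscale s "free_lift s B" by (rule linear_free_lift[OF vs])
  have "free_lift s B r = 0" if r: "r \<in> tensor_relations" for r
  proof -
    consider f f' g where "r = free_pair (f + f') g - free_pair f g - free_pair f' g"
      | f g g' where "r = free_pair f (g + g') - free_pair f g - free_pair f g'"
      | c f g where "r = free_pair (qscale c f) g - fscale c (free_pair f g)"
      | c f g where "r = free_pair f (qscale c g) - fscale c (free_pair f g)"
      using r unfolding tensor_relations_def by blast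
    then show ?thesis
      by cases (simp_all only: l.diff l.scale free_lift_pair[OF vs] a.add b.add a.scale b.scale
          add_diff_cancel_left' diff_self)
  qed
  then have "free_lift s B (t - u) = 0"
    using assms unfolding tensor_rel_def by (rule l.eq_0_on_span)
  then show ?thesis by (simp add: l.diff)
qed

lemma tensor_lift_abs: "tensor_lift s B (abs_qsym_tensor t) = free_lift s B t"
  unfolding tensor_lift_def
  by (rule free_lift_cong)
    (rule Quotient_rep_abs[OF Quotient_qsym_tensor equivp_reflp[OF equivp_tensor_rel]])

lemma tensor_lift_tensor: "tensor_lift s B (tensor f g) = B f g"
proof -
  interpret b: Vector_Spaces.linear qscale s "B f" for f by (rule B2)
  show ?thesis
    unfolding tensor.abs_eq tensor_lift_abs by (rule free_lift_pair) (rule b.vs2.vector_space_axioms)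
qed

lemma linear_tensor_lift: "Vector_Spaces.linear tscale s (tensor_lift s B)"
proof -
  interpret b: Vector_Spaces.linear qscale s "B f" for f by (rule B2)
  have vs: "vector_space s" by (rule b.vs2.vector_space_axioms)
  interpret l: Vector_Spaces.linear fscale s "free_lift s B" by (rule linear_free_lift[OF vs])
  show ?thesis
  proof (intro Vector_Spaces.linear.intro vs tensor.vector_space_axioms module_hom.intro
      tensor.module_axioms b.vs2.module_axioms module_hom_axioms.intro)
    fix c T U
    obtain t u where T: "T = abs_qsym_tensor t" "U = abs_qsym_tensor u"
      using Quotient_abs_rep[OF Quotient_qsym_tensor] by metis
    show "tensor_lift s B (T + U) = tensor_lift s B T + tensor_lift s B U"
      unfolding T plus_qsym_tensor.abs_eq tensor_lift_abs by (rule l.add)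
    show "tensor_lift s B (tscale c T) = s c (tensor_lift s B T)"
      unfolding T tscale.abs_eq tensor_lift_abs by (rule l.scale)
  qed
qed

end

text \<open>\<open>\<phi> \<otimes> \<psi>\<close> for linear \<open>\<phi>\<close> and \<open>\<psi>\<close>\<close>

definition tensor_map :: "(qsym \<Rightarrow> qsym) \<Rightarrow> (qsym \<Rightarrow> qsym) \<Rightarrow> qsym_tensor \<Rightarrow> qsym_tensor" where
  "tensor_map \<phi> \<psi> = tensor_lift tscale (\<lambda>f g. tensor (\<phi> f) (\<psi> g))"

lemma
  assumes \<phi>: "Vector_Spaces.linear qscale qscale \<phi>" and \<psi>: "Vector_Spaces.linear qscale qscale \<psi>"
  shows linear_tensor_map: "Vector_Spaces.linear tscale tscale (tensor_map \<phi> \<psi>)"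
    and tensor_map_tensor: "tensor_map \<phi> \<psi> (tensor f g) = tensor (\<phi> f) (\<psi> g)"
proof -
  interpret a: Vector_Spaces.linear qscale qscale \<phi> by fact
  interpret b: Vector_Spaces.linear qscale qscale \<psi> by fact
  have 1: "Vector_Spaces.linear qscale tscale (\<lambda>f. tensor (\<phi> f) (\<psi> g))" for g
    by unfold_locales (simp_all add: a.add a.scale tensor_bilinear)
  have 2: "Vector_Spaces.linear qscale tscale (\<lambda>g. tensor (\<phi> f) (\<psi> g))" for f
    by unfold_locales (simp_all add: b.add b.scale tensor_bilinear)
  show "Vector_Spaces.linear tscale tscale (tensor_map \<phi> \<psi>)"
    unfolding tensor_map_def using 1 2 by (rule linear_tensor_lift)
  show "tensor_map \<phi> \<psi> (tensor f g) = tensor (\<phi> f) (\<psi> g)"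
    unfolding tensor_map_def using 1 2 by (rule tensor_lift_tensor)
qed

definition deconcat :: "nat list \<Rightarrow> qsym_tensor" where
  "deconcat \<alpha> = (\<Sum>(\<beta>, \<gamma>) | \<beta> @ \<gamma> = \<alpha>. tensor (qsym_M \<beta>) (qsym_M \<gamma>))"

text \<open>The linear extension of \<open>\<Delta>(M\<^sub>\<alpha>) = \<Sum> M\<^sub>\<beta> \<otimes> M\<^sub>\<gamma>\<close>, see \<open>linear_comult\<close> and \<open>comult_M\<close>.\<close>

definition comult :: "qsym \<Rightarrow> qsym_tensor" where
  "comult f = (\<Sum>\<alpha> | \<alpha> \<in> compositions \<and> qcoeff f \<alpha> \<noteq> 0. tscale (qcoeff f \<alpha>) (deconcat \<alpha>))"

definition counit :: "qsym \<Rightarrow> rat" where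
  "counit f = qcoeff f []"

lemma finite_deconcat: "finite {(\<beta>, \<gamma>). \<beta> @ \<gamma> = \<alpha>}"
proof (rule finite_subset)
  show "{(\<beta>, \<gamma>). \<beta> @ \<gamma> = \<alpha>} \<subseteq> (\<lambda>i. (take i \<alpha>, drop i \<alpha>)) ` {..length \<alpha>}"
  proof (rule subrelI)
    fix \<beta> \<gamma> assume "(\<beta>, \<gamma>) \<in> {(\<beta>, \<gamma>). \<beta> @ \<gamma> = \<alpha>}"
    then show "(\<beta>, \<gamma>) \<in> (\<lambda>i. (take i \<alpha>, drop i \<alpha>)) ` {..length \<alpha>}"
      by (intro image_eqI[of _ _ "length \<beta>"]) auto
  qed
qed simp

lemma linear_comult: "Vector_Spaces.linear qscale tscale comult"
proof -
  have sup: "comult f = (\<Sum>\<alpha>\<in>K. tscale (qcoeff f \<alpha>) (deconcat \<alpha>))"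
    if "finite K" "{\<alpha> \<in> compositions. qcoeff f \<alpha> \<noteq> 0} \<subseteq> K" "K \<subseteq> compositions" for f K
    unfolding comult_def using that by (intro sum.mono_neutral_left) auto
  show ?thesis
  proof unfold_locales
    fix f g
    let ?K = "{\<alpha> \<in> compositions. qcoeff f \<alpha> \<noteq> 0} \<union> {\<alpha> \<in> compositions. qcoeff g \<alpha> \<noteq> 0}"
    have K: "finite ?K" "{\<alpha> \<in> compositions. qcoeff f \<alpha> \<noteq> 0} \<subseteq> ?K" "{\<alpha> \<in> compositions. qcoeff g \<alpha> \<noteq> 0} \<subseteq> ?K"
      "{\<alpha> \<in> compositions. qcoeff (f + g) \<alpha> \<noteq> 0} \<subseteq> ?K" "?K \<subseteq> compositions"
      using finite_qcoeff by auto
    show "comult (f + g) = comult f + comult g"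
      unfolding sup[OF K(1,2,5)] sup[OF K(1,3,5)] sup[OF K(1,4,5)]
      by (simp add: tensor.scale_left_distrib sum.distrib)
  next
    fix c f
    let ?K = "{\<alpha> \<in> compositions. qcoeff f \<alpha> \<noteq> 0}"
    have K: "finite ?K" "?K \<subseteq> ?K" "{\<alpha> \<in> compositions. qcoeff (qscale c f) \<alpha> \<noteq> 0} \<subseteq> ?K" "?K \<subseteq> compositions"
      using finite_qcoeff by auto
    show "comult (qscale c f) = tscale c (comult f)"
      unfolding sup[OF K(1,2,4)] sup[OF K(1,3,4)] by (simp add: tensor.scale_sum_right)
  qed
qed

lemma comult_M:
  assumes "\<alpha> \<in> compositions"
  shows "comult (qsym_M \<alpha>) = (\<Sum>(\<beta>, \<gamma>) | \<beta> @ \<gamma> = \<alpha>. tensor (qsym_M \<beta>) (qsym_M \<gamma>))"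
proof -
  have "{\<beta> \<in> compositions. qcoeff (qsym_M \<alpha>) \<beta> \<noteq> 0} = {\<alpha>}"
    using assms by (auto simp: qcoeff_M split: if_splits)
  then show ?thesis using assms by (simp add: comult_def deconcat_def qcoeff_M)
qed

lemma counit_M: "\<alpha> \<in> compositions \<Longrightarrow> counit (qsym_M \<alpha>) = (if \<alpha> = [] then 1 else 0)"
  using qcoeff_M[of "[]" \<alpha>] by (auto simp: counit_def compositions_def)

lemma linear_counit: "Vector_Spaces.linear qscale (*) counit"
  by unfold_locales (simp_all add: counit_def algebra_simps)

text \<open>No condition on the antipode is needed: bialgebra maps between Hopf algebras commute with the
  antipodes, and the inverse of a bijective bialgebra map is again one.\<close>

definition hopf_automorphism :: "(qsym \<Rightarrow> qsym) \<Rightarrow> bool" where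
  "hopf_automorphism \<phi> \<longleftrightarrow>
     bij \<phi> \<and> Vector_Spaces.linear qscale qscale \<phi> \<and>
     \<phi> 1 = 1 \<and> (\<forall>f g. \<phi> (f * g) = \<phi> f * \<phi> g) \<and>
     (\<forall>f. counit (\<phi> f) = counit f) \<and>
     (\<forall>f. comult (\<phi> f) = tensor_map \<phi> \<phi> (comult f))"

definition graded :: "(qsym \<Rightarrow> qsym) \<Rightarrow> bool" where
  "graded \<phi> \<longleftrightarrow> (\<forall>n. \<phi> ` qsym_deg n \<subseteq> qsym_deg n)"

end

theory Submission
  imports Defs
begin

text \<open>
  \<^bold>\<open>Why \<open>\<Psi>\<close> is an automorphism.\<close>
  Compositions are read as words in two letters, \<open>1 # \<alpha>\<close> and \<open>incr \<alpha>\<close>, and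
  complementation exchanges the letters.  The coproduct of \<open>F\<^sub>\<alpha>\<close> is the sum over all cuts of
  the word of \<open>\<alpha>\<close> (\<open>comult_F\<close>), and cutting commutes with exchanging letters, so \<open>\<Psi>\<close> respects the
  coproduct.  For the product, let \<open>D\<^sub>a\<close> (\<open>qtail a\<close>) extract the coefficient of
  \<open>x\<^sub>0\<^sup>a\<close>.  The power series \<open>D(t) = \<Sum> D\<^sub>a t\<^sup>a\<close> is multiplicative.  The conjugates
  \<open>E\<^sub>a = \<Psi> D\<^sub>a \<Psi>\<close> satisfy \<open>E(t) D(-t) = 1\<close>, which is a cancellation on words
  (\<open>conj_qtail_qtail_alternating\<close>).  So \<open>E(t)\<close> inverts a multiplicative series and is itself
  multiplicative (\<open>conj_qtail_times\<close>).  Since \<open>D\<^sub>a \<Psi> = \<Psi> E\<^sub>a\<close>, comparing the coefficients of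
  \<open>\<Psi>(f g)\<close> and \<open>\<Psi>(f) \<Psi>(g)\<close> by repeatedly extracting the first variable shows that they agree.

  \<^bold>\<open>Why there is no other one.\<close>
  A graded automorphism \<open>\<phi>\<close> that permutes the fundamental functions permutes those of each degree.
  In degree at least 3, \<open>F\<^sub>\<alpha>\<close> is determined among the fundamental functions by the part
  of its coproduct that lies in smaller degrees.  Hence \<open>\<phi>\<close> is determined by its action on the two
  fundamental functions of degree 2 (\<open>graded_coalgebra_map_eqI\<close>): if it fixes them it is the identity,
  and if it swaps them it is \<open>\<Psi>\<close>.\<close>

section \<open>Coefficients at lists that may contain zeros\<close>

text \<open>By quasisymmetry, the variables with exponent 0 can be skipped.  Lists with zeros arise when a
  monomial is split as a product of two.  In such lists positions keep their meaning as variables,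
  so multiplication is a plain convolution.\<close>

lemma qcoeff_strip_zeros: "qcoeff f w = qcoeff f (filter (\<lambda>x. x \<noteq> 0) w)"
proof -
  have *: "\<exists>js. length js = length (filter (\<lambda>x. x \<noteq> 0) w) \<and> sorted_wrt (<) js \<and> set js \<subseteq> set ks \<and>
      monom_at js (filter (\<lambda>x. x \<noteq> 0) w) = monom_at ks w"
    if "length ks = length w" "sorted_wrt (<) ks" for ks
    using that
  proof (induction ks w rule: list_induct2)
    case Nil
    then show ?case by simp
  next
    case (Cons k ks x w)
    then obtain js where js: "length js = length (filter (\<lambda>x. x \<noteq> 0) w)" "sorted_wrt (<) js"
      "set js \<subseteq> set ks" "monom_at js (filter (\<lambda>x. x \<noteq> 0) w) = monom_at ks w" by auto
    show ?case
    proof (cases "x = 0")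
      case True
      then show ?thesis using js by (intro exI[of _ js]) (auto simp: monom_at_def)
    next
      case False
      then show ?thesis using js Cons.prems by (intro exI[of _ "k # js"]) (auto simp: monom_at_def)
    qed
  qed
  let ?v = "filter (\<lambda>x. x \<noteq> 0) w"
  obtain js where js: "length js = length ?v" "sorted_wrt (<) js"
    "monom_at js ?v = monom_at [0..<length w] w"
    using *[of "[0..<length w]"] by (auto simp: sorted_wrt_upt)
  have "quasisymmetric (coeff_of f)" using coeff_of by blast
  then have "coeff_of f (monom_at js ?v) = coeff_of f (monom_at [0..<length ?v] ?v)"
    using js by (intro monom_at_weak) (auto simp: sorted_wrt_upt)
  then show ?thesis using js(3) by (simp add: qcoeff_def)
qed

lemma qcoeff_times:
  "qcoeff (f * g) w = (\<Sum>(u, v) | length u = length w \<and> length v = length w \<and> map2 (+) u v = w.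
     qcoeff f u * qcoeff g v)"
proof -
  define l where "l = [0..<length w]"
  have d: "distinct l" "length l = length w" by (auto simp: l_def)
  have restrict: "monom_at l (map (Poly_Mapping.lookup p) l) = p \<and> monom_at l (map (Poly_Mapping.lookup q) l) = q"
    if pq: "p + q = monom_at l w" for p q
  proof -
    have "Poly_Mapping.lookup p i + Poly_Mapping.lookup q i = Poly_Mapping.lookup (monom_at l w) i" for i
      by (simp flip: pq add: lookup_add)
    then have "Poly_Mapping.lookup p i = 0 \<and> Poly_Mapping.lookup q i = 0" if "i \<notin> set l" for i
      using lookup_monom_at_notin[OF that] by (metis add_is_0)
    then have "Poly_Mapping.keys p \<subseteq> set l" "Poly_Mapping.keys q \<subseteq> set l"
      by (auto simp: in_keys_iff)
    then show ?thesis using monom_at_surj[OF d(1)] by metis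
  qed
  have lookup: "map (Poly_Mapping.lookup (monom_at l u)) l = u" if "length u = length l" for u
    using that d by (intro nth_equalityI) (simp_all add: lookup_monom_at)
  have "qcoeff (f * g) w = (\<Sum>(p, q) | p + q = monom_at l w. coeff_of f p * coeff_of g q)"
    by (simp add: qcoeff_def times_qsym.rep_eq ps_times_def l_def)
  also have "\<dots> = (\<Sum>(u, v) | length u = length w \<and> length v = length w \<and> map2 (+) u v = w.
     coeff_of f (monom_at l u) * coeff_of g (monom_at l v))"
  proof (rule sum.reindex_bij_witness[of _ "\<lambda>(u, v). (monom_at l u, monom_at l v)"
        "\<lambda>(p, q). (map (Poly_Mapping.lookup p) l, map (Poly_Mapping.lookup q) l)"])
    fix x :: "nat list \<times> nat list"
    assume x: "x \<in> {(u, v). length u = length w \<and> length v = length w \<and> map2 (+) u v = w}"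
    obtain u v where uv: "x = (u, v)" by (cases x)
    have len: "length u = length l" "length v = length l" using x uv d by simp_all
    have "monom_at l u + monom_at l v = monom_at l w"
      using monom_at_add[OF len] x uv by simp
    then show "(case case x of (u, v) \<Rightarrow> (monom_at l u, monom_at l v) of
        (p, q) \<Rightarrow> (map (Poly_Mapping.lookup p) l, map (Poly_Mapping.lookup q) l)) = x"
      "(case x of (u, v) \<Rightarrow> (monom_at l u, monom_at l v)) \<in> {(p, q). p + q = monom_at l w}"
      using uv lookup[OF len(1)] lookup[OF len(2)] by simp_all
  next
    fix x :: "monom \<times> monom" assume x: "x \<in> {(p, q). p + q = monom_at l w}"
    obtain p q where pq: "x = (p, q)" "p + q = monom_at l w" using x by auto
    show "(case case x of (p, q) \<Rightarrow> (map (Poly_Mapping.lookup p) l, map (Poly_Mapping.lookup q) l) of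
        (u, v) \<Rightarrow> (monom_at l u, monom_at l v)) = x"
      "(case case x of (p, q) \<Rightarrow> (map (Poly_Mapping.lookup p) l, map (Poly_Mapping.lookup q) l) of
        (u, v) \<Rightarrow> coeff_of f (monom_at l u) * coeff_of g (monom_at l v))
        = (case x of (p, q) \<Rightarrow> coeff_of f p * coeff_of g q)"
      using restrict[OF pq(2)] unfolding pq(1) by simp_all
    have "map2 (+) (map (Poly_Mapping.lookup p) l) (map (Poly_Mapping.lookup q) l)
        = map (Poly_Mapping.lookup (p + q)) l"
      by (intro nth_equalityI) (simp_all add: lookup_add)
    also have "\<dots> = w" unfolding pq(2) by (rule lookup) (simp add: d)
    finally show "(case x of (p, q) \<Rightarrow> (map (Poly_Mapping.lookup p) l, map (Poly_Mapping.lookup q) l))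
        \<in> {(u, v). length u = length w \<and> length v = length w \<and> map2 (+) u v = w}"
      unfolding pq(1) using d by simp
  qed
  also have "\<dots> = (\<Sum>(u, v) | length u = length w \<and> length v = length w \<and> map2 (+) u v = w.
     qcoeff f u * qcoeff g v)"
  proof (rule sum.cong[OF refl])
    fix x :: "nat list \<times> nat list"
    assume x: "x \<in> {(u, v). length u = length w \<and> length v = length w \<and> map2 (+) u v = w}"
    obtain u v where uv: "x = (u, v)" by (cases x)
    then have "length u = length w" "length v = length w" using x by simp_all
    then show "(case x of (u, v) \<Rightarrow> coeff_of f (monom_at l u) * coeff_of g (monom_at l v))
        = (case x of (u, v) \<Rightarrow> qcoeff f u * qcoeff g v)"
      unfolding uv qcoeff_def l_def by simp
  qed
  finally show ?thesis .
qed

section \<open>Extracting powers of the first variable\<close>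

text \<open>The coefficient of \<open>x\<^sub>0\<^sup>a\<close> in \<open>f\<close>, as a quasisymmetric function of the
  remaining variables.  For \<open>a > 0\<close> it sends \<open>M\<close> of a composition that starts with \<open>a\<close> to \<open>M\<close> of
  the rest, and the other monomial functions to 0.\<close>

definition qtail :: "nat \<Rightarrow> qsym \<Rightarrow> qsym" where
  "qtail a f = (\<Sum>\<alpha> | \<alpha> \<in> compositions \<and> qcoeff f (a # \<alpha>) \<noteq> 0. qscale (qcoeff f (a # \<alpha>)) (qsym_M \<alpha>))"

lemma qcoeff_qtail: "qcoeff (qtail a f) w = qcoeff f (a # w)"
proof -
  have comp: "qcoeff (qtail a f) \<beta> = qcoeff f (a # \<beta>)" if \<beta>: "\<beta> \<in> compositions" for \<beta>
  proof -
    let ?A = "{\<alpha> \<in> compositions. qcoeff f (a # \<alpha>) \<noteq> 0}"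
    obtain d where d: "\<And>m. coeff_of f m \<noteq> 0 \<Longrightarrow> mdegree m \<le> d"
      using coeff_of[of f] unfolding bounded_degree_def by blast
    have "sum_list \<alpha> \<le> d" if "qcoeff f (a # \<alpha>) \<noteq> 0" for \<alpha>
    proof -
      have "mdegree (monom_at [0..<length (a # \<alpha>)] (a # \<alpha>)) \<le> d"
        using d that unfolding qcoeff_def by blast
      then show ?thesis by (subst (asm) mdegree_monom_at) auto
    qed
    then have "?A \<subseteq> (\<Union>n\<le>d. {\<alpha> \<in> compositions. sum_list \<alpha> = n})" by auto
    moreover have "finite (\<Union>n\<le>d. {\<alpha> \<in> compositions. sum_list \<alpha> = n})"
      using finite_compositions by (intro finite_UN_I) auto
    ultimately have fin: "finite ?A" by (rule finite_subset)
    have "qcoeff (qtail a f) \<beta> = (\<Sum>\<alpha>\<in>?A. if \<beta> = \<alpha> then qcoeff f (a # \<alpha>) else 0)"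
      unfolding qtail_def qcoeff_sum using \<beta> by (intro sum.cong) (auto simp: qcoeff_M)
    then show ?thesis using fin \<beta> by (simp add: sum.delta)
  qed
  let ?v = "filter (\<lambda>x. x \<noteq> 0) w"
  have "qcoeff (qtail a f) w = qcoeff (qtail a f) ?v" by (rule qcoeff_strip_zeros)
  also have "\<dots> = qcoeff f (a # ?v)" by (rule comp) (auto simp: compositions_def)
  also have "\<dots> = qcoeff f (filter (\<lambda>x. x \<noteq> 0) (a # ?v))" by (rule qcoeff_strip_zeros)
  also have "\<dots> = qcoeff f (filter (\<lambda>x. x \<noteq> 0) (a # w))" by simp
  also have "\<dots> = qcoeff f (a # w)" by (rule qcoeff_strip_zeros[symmetric])
  finally show ?thesis .
qed

lemma qtail_0 [simp]: "qtail 0 f = f"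
proof (rule qcoeff_eqI)
  fix \<alpha>
  have "qcoeff (qtail 0 f) \<alpha> = qcoeff f (filter (\<lambda>x. x \<noteq> 0) (0 # \<alpha>))"
    unfolding qcoeff_qtail by (rule qcoeff_strip_zeros)
  also have "\<dots> = qcoeff f \<alpha>" using qcoeff_strip_zeros[of f \<alpha>] by simp
  finally show "qcoeff (qtail 0 f) \<alpha> = qcoeff f \<alpha>" .
qed

lemma qcoeff_times_Nil: "qcoeff (f * g) [] = qcoeff f [] * qcoeff g []"
proof -
  have "{(u, v). length u = length ([] :: nat list) \<and> length v = length ([] :: nat list) \<and> map2 (+) u v = ([] :: nat list)} = {([], [])}"
    by auto
  then show ?thesis by (simp add: qcoeff_times)
qed

lemma qtail_linear: "qtail a (f + g) = qtail a f + qtail a g" "qtail a (qscale c f) = qscale c (qtail a f)"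
  by (rule qcoeff_eqI, simp add: qcoeff_qtail)+

text \<open>Setting \<open>x\<^sub>0 = t\<close> and renumbering the other variables is a ring homomorphism into power series in \<open>t\<close> over \<open>QSym\<close>,
  and \<open>qtail a\<close> reads off the coefficient of \<open>t\<^sup>a\<close>.\<close>

lemma qtail_times: "qtail a (f * g) = (\<Sum>i\<le>a. qtail i f * qtail (a - i) g)"
proof (rule qcoeff_eqI)
  fix w
  let ?W = "\<lambda>w :: nat list. {(u, v). length u = length w \<and> length v = length w \<and> map2 (+) u v = w}"
  have "qcoeff (qtail a (f * g)) w = (\<Sum>(u, v)\<in>?W (a # w). qcoeff f u * qcoeff g v)"
    by (simp add: qcoeff_qtail qcoeff_times)
  also have "\<dots> = (\<Sum>(i, u, v)\<in>{..a} \<times> ?W w. qcoeff f (i # u) * qcoeff g ((a - i) # v))"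
  proof (rule sum.reindex_bij_witness[of _ "\<lambda>(i, u, v). (i # u, (a - i) # v)" "\<lambda>(u, v). (hd u, tl u, tl v)"])
    fix x assume "x \<in> ?W (a # w)"
    moreover from this obtain i u j v where "x = (i # u, j # v)"
      by (cases x; cases "fst x"; cases "snd x") simp_all
    ultimately have x: "x = (i # u, j # v)" "i + j = a" "(u, v) \<in> ?W w" by simp_all
    show "(case case x of (u, v) \<Rightarrow> (hd u, tl u, tl v) of (i, u, v) \<Rightarrow> (i # u, (a - i) # v)) = x"
      "(case x of (u, v) \<Rightarrow> (hd u, tl u, tl v)) \<in> {..a} \<times> ?W w"
      "(case case x of (u, v) \<Rightarrow> (hd u, tl u, tl v) of (i, u, v) \<Rightarrow> qcoeff f (i # u) * qcoeff g ((a - i) # v))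
        = (case x of (u, v) \<Rightarrow> qcoeff f u * qcoeff g v)"
      using x by (simp_all flip: x(2))
  next
    fix y assume y: "y \<in> {..a} \<times> ?W w"
    obtain i u v where iuv: "y = (i, u, v)" by (cases y)
    with y have "i \<le> a" "length u = length w" "length v = length w" "map2 (+) u v = w" by simp_all
    then show "(case case y of (i, u, v) \<Rightarrow> (i # u, (a - i) # v) of (u, v) \<Rightarrow> (hd u, tl u, tl v)) = y"
      "(case y of (i, u, v) \<Rightarrow> (i # u, (a - i) # v)) \<in> ?W (a # w)"
      using iuv by simp_all
  qed
  also have "\<dots> = (\<Sum>i\<le>a. \<Sum>(u, v)\<in>?W w. qcoeff f (i # u) * qcoeff g ((a - i) # v))"
    by (simp add: sum.cartesian_product)
  also have "\<dots> = qcoeff (\<Sum>i\<le>a. qtail i f * qtail (a - i) g) w"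
    by (simp add: qcoeff_sum qcoeff_times qcoeff_qtail)
  finally show "qcoeff (qtail a (f * g)) w = qcoeff (\<Sum>i\<le>a. qtail i f * qtail (a - i) g) w" .
qed

section \<open>Linear maps on the fundamental basis\<close>

lemma linear_eq_on_fundamental:
  assumes f: "Vector_Spaces.linear qscale s f" and g: "Vector_Spaces.linear qscale s g"
    and eq: "\<And>\<alpha>. \<alpha> \<in> compositions \<Longrightarrow> f (qsym_F \<alpha>) = g (qsym_F \<alpha>)"
  shows "f x = g x"
proof -
  interpret f: Vector_Spaces.linear qscale s f by fact
  interpret vector_space_pair qscale s ..
  show ?thesis
    by (rule linear_eq_on_span[OF f g, of "qsym_F ` compositions"]) (use eq span_qsym_F in auto)
qed

section \<open>Compositions as words\<close>

text \<open>
  Nonempty compositions of \<open>n\<close> correspond to words of length \<open>n - 1\<close> in two letters: prepending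
  a part 1, or adding 1 to the first part.  Complementation exchanges the two letters.  On the empty
  composition both operations give \<open>[1]\<close>, so every statement about compositions can be
  proved with one base case and two symmetric steps.\<close>

fun incr :: "nat list \<Rightarrow> nat list" where
  "incr [] = [1]"
| "incr (a # \<alpha>) = Suc a # \<alpha>"

lemma compositions_simps [simp]:
  "[] \<in> compositions" "a # \<alpha> \<in> compositions \<longleftrightarrow> a \<noteq> 0 \<and> \<alpha> \<in> compositions"
  "incr \<alpha> \<in> compositions \<longleftrightarrow> tl \<alpha> \<in> compositions"
  by (cases \<alpha>; auto simp: compositions_def)+

lemma tl_compositions: "\<alpha> \<in> compositions \<Longrightarrow> tl \<alpha> \<in> compositions"
  by (cases \<alpha>) auto

lemma sum_list_incr [simp]: "sum_list (incr \<alpha>) = Suc (sum_list \<alpha>)"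
  by (cases \<alpha>) auto

lemma composition_induct [consumes 1, case_names Nil one incr]:
  assumes "\<alpha> \<in> compositions"
    and nil: "P []"
    and one: "\<And>\<alpha>. \<alpha> \<in> compositions \<Longrightarrow> P \<alpha> \<Longrightarrow> P (1 # \<alpha>)"
    and incr: "\<And>\<alpha>. \<alpha> \<in> compositions \<Longrightarrow> P \<alpha> \<Longrightarrow> P (incr \<alpha>)"
  shows "P \<alpha>"
  using assms(1)
proof (induction "sum_list \<alpha>" arbitrary: \<alpha> rule: less_induct)
  case less
  consider "\<alpha> = []" | \<beta> where "\<alpha> = 1 # \<beta>" | b \<beta> where "\<alpha> = Suc (Suc b) # \<beta>"
    using less.prems by (metis One_nat_def compositions_simps(2) neq_Nil_conv not0_implies_Suc)
  then show ?case
  proof cases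
    case 3
    then have "P (incr (Suc b # \<beta>))" using less by (intro incr) auto
    then show ?thesis using 3 by simp
  qed (use less nil one in auto)
qed

lemma refinesE:
  assumes "refines \<beta> \<alpha>"
  obtains bs where "concat bs = \<beta>" "map sum_list bs = \<alpha>" "[] \<notin> set bs"
  using assms unfolding refines_def by (elim exE conjE)

lemma refinesI: "concat bs = \<beta> \<Longrightarrow> map sum_list bs = \<alpha> \<Longrightarrow> [] \<notin> set bs \<Longrightarrow> refines \<beta> \<alpha>"
  unfolding refines_def by (intro exI conjI)

lemma refines_Nil_left [simp]: "refines [] \<alpha> \<longleftrightarrow> \<alpha> = []"
  unfolding refines_def by (auto simp: concat_eq_Nil_conv) (metis list.set_intros(1) neq_Nil_conv)

lemma refines_Nil_right [simp]: "refines \<beta> [] \<longleftrightarrow> \<beta> = []"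
  unfolding refines_def by auto

text \<open>The first block of the refinement either consists of \<open>b\<close> alone or leaves a block of
  sum \<open>a - b\<close> when \<open>b\<close> is removed.\<close>

lemma refines_Cons_Cons:
  "refines (b # \<beta>) (a # \<alpha>) \<longleftrightarrow> a = b \<and> refines \<beta> \<alpha> \<or> b \<le> a \<and> refines \<beta> ((a - b) # \<alpha>)"
proof
  assume "refines (b # \<beta>) (a # \<alpha>)"
  then obtain bs where bs: "concat bs = b # \<beta>" "map sum_list bs = a # \<alpha>" "[] \<notin> set bs"
    by (rule refinesE)
  have "\<exists>c' cs. bs = (b # c') # cs"
  proof (cases bs)
    case (Cons c cs)
    then show ?thesis using bs by (cases c) simp_all
  qed (use bs in simp)
  then obtain c' cs where c: "bs = (b # c') # cs" by blast
  show "a = b \<and> refines \<beta> \<alpha> \<or> b \<le> a \<and> refines \<beta> ((a - b) # \<alpha>)"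
  proof (cases "c' = []")
    case True
    then have "refines \<beta> \<alpha>" using bs c by (intro refinesI[of cs]) simp_all
    then show ?thesis using True bs c by simp
  next
    case False
    have "refines \<beta> ((a - b) # \<alpha>)"
      using bs c False by (intro refinesI[of "c' # cs"]) auto
    moreover have "b \<le> a" using bs(2) c by simp
    ultimately show ?thesis by blast
  qed
next
  assume "a = b \<and> refines \<beta> \<alpha> \<or> b \<le> a \<and> refines \<beta> ((a - b) # \<alpha>)"
  then show "refines (b # \<beta>) (a # \<alpha>)"
  proof (elim disjE conjE)
    assume "a = b" "refines \<beta> \<alpha>"
    from this(2) obtain bs where "concat bs = \<beta>" "map sum_list bs = \<alpha>" "[] \<notin> set bs"
      by (rule refinesE)
    then show ?thesis using \<open>a = b\<close> by (intro refinesI[of "[b] # bs"]) simp_all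
  next
    assume le: "b \<le> a" and "refines \<beta> ((a - b) # \<alpha>)"
    from this(2) obtain bs where bs: "concat bs = \<beta>" "map sum_list bs = (a - b) # \<alpha>" "[] \<notin> set bs"
      by (rule refinesE)
    from bs(2) obtain c cs where "bs = c # cs" by (cases bs) simp_all
    then show ?thesis using bs le by (intro refinesI[of "(b # c) # cs"]) simp_all
  qed
qed

lemma refines_0_Cons: "\<beta> \<in> compositions \<Longrightarrow> \<not> refines \<beta> (0 # \<alpha>)"
  by (cases \<beta>) (auto simp: refines_Cons_Cons)

lemma refines_one_Cons:
  "\<beta> \<in> compositions \<Longrightarrow> refines (Suc j # \<beta>) (1 # \<alpha>) \<longleftrightarrow> j = 0 \<and> refines \<beta> \<alpha>"
  by (auto simp: refines_Cons_Cons refines_0_Cons)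

lemma refines_incr:
  "\<alpha> \<in> compositions \<Longrightarrow> \<beta> \<in> compositions \<Longrightarrow>
    refines (Suc j # \<beta>) (incr \<alpha>) \<longleftrightarrow> (if j = 0 then refines \<beta> \<alpha> else refines (j # \<beta>) \<alpha>)"
  by (cases \<alpha>) (auto simp: refines_Cons_Cons refines_0_Cons)

lemma qsym_F_Nil: "qsym_F [] = 1"
proof -
  have "{\<beta> \<in> compositions. refines \<beta> []} = {[]}" by auto
  then have "qsym_F [] = qsym_M []" by (simp add: qsym_F_def)
  also have "\<dots> = 1"
  proof (rule qcoeff_eqI)
    fix \<alpha> assume a: "\<alpha> \<in> compositions"
    have "qcoeff 1 \<alpha> = (if \<alpha> = [] then 1 else 0)"
      using a monom_at_eq_0_iff[of "[0..<length \<alpha>]" \<alpha>]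
      by (cases \<alpha>) (auto simp: qcoeff_def one_qsym.rep_eq ps_one_def)
    then show "qcoeff (qsym_M []) \<alpha> = qcoeff 1 \<alpha>" using a by (simp add: qcoeff_M)
  qed
  finally show ?thesis .
qed

lemma qtail_one: "qtail (Suc j) 1 = 0"
proof (rule qcoeff_eqI)
  fix \<beta> :: "nat list" assume "\<beta> \<in> compositions"
  then show "qcoeff (qtail (Suc j) 1) \<beta> = qcoeff 0 \<beta>"
    unfolding qcoeff_qtail by (simp flip: qsym_F_Nil add: qcoeff_F)
qed

text \<open>A part 1 cannot be refined, so only the exponents 0 and 1 of the first variable occur.  The
  companion for \<open>incr\<close> lowers the exponent by one, which is the recursion that the
  alternating sum below feeds on.\<close>

lemma qtail_F_one: "qtail (Suc j) (qsym_F (1 # \<alpha>)) = (if j = 0 then qsym_F \<alpha> else 0)"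
proof (rule qcoeff_eqI)
  fix \<beta> assume "\<beta> \<in> compositions"
  then show "qcoeff (qtail (Suc j) (qsym_F (1 # \<alpha>))) \<beta> = qcoeff (if j = 0 then qsym_F \<alpha> else 0) \<beta>"
    using refines_one_Cons[of \<beta> j \<alpha>] by (auto simp: qcoeff_qtail qcoeff_F)
qed

lemma qtail_F_incr:
  assumes "\<alpha> \<in> compositions"
  shows "qtail (Suc j) (qsym_F (incr \<alpha>)) = qtail j (qsym_F \<alpha>)"
proof (rule qcoeff_eqI)
  fix \<beta> assume "\<beta> \<in> compositions"
  then show "qcoeff (qtail (Suc j) (qsym_F (incr \<alpha>))) \<beta> = qcoeff (qtail j (qsym_F \<alpha>)) \<beta>"
    using refines_incr[OF assms, of \<beta> j] by (cases "j = 0") (auto simp: qcoeff_qtail qcoeff_F)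
qed

section \<open>Complements\<close>

lemma comp_compl_eqI:
  assumes "\<beta> \<in> compositions" "sum_list \<beta> = sum_list \<alpha>"
    "comp_set \<beta> = {1..<sum_list \<alpha>} - comp_set \<alpha>"
  shows "comp_compl \<alpha> = \<beta>"
  using assms comp_compl[of \<alpha>] by (intro comp_set_inj) auto

lemma comp_compl_Nil [simp]: "comp_compl [] = []"
  by (rule comp_compl_eqI) auto

lemma comp_compl_involution: "\<alpha> \<in> compositions \<Longrightarrow> comp_compl (comp_compl \<alpha>) = \<alpha>"
  using comp_set_subset[of \<alpha>] by (intro comp_compl_eqI) (auto simp: comp_compl)

lemma comp_set_incr: "comp_set (incr \<alpha>) = Suc ` comp_set \<alpha>"
  by (cases \<alpha>) (auto simp: comp_set_Cons)

lemma comp_set_one_Cons: "comp_set (1 # \<alpha>) = (if \<alpha> = [] then {} else insert 1 (Suc ` comp_set \<alpha>))"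
  by (auto simp: comp_set_Cons)

lemma atLeast1_lessThan_Suc: "{1..<Suc n} = (if n = 0 then {} else insert 1 (Suc ` {1..<n}))"
  by (auto simp: image_Suc_atLeastLessThan)

lemma sum_list_eq_0_composition: "\<alpha> \<in> compositions \<Longrightarrow> sum_list \<alpha> = 0 \<longleftrightarrow> \<alpha> = []"
  by (cases \<alpha>) auto

text \<open>For nonempty \<open>\<alpha>\<close>, the set of \<open>1 # \<alpha>\<close> is the shifted set of \<open>\<alpha>\<close> with 1 added, and the set of \<open>incr \<alpha>\<close> is
  the shifted set alone.\<close>

lemma comp_compl_one_Cons:
  assumes "\<alpha> \<in> compositions" shows "comp_compl (1 # \<alpha>) = incr (comp_compl \<alpha>)"
proof (rule comp_compl_eqI)
  show "incr (comp_compl \<alpha>) \<in> compositions" by (simp add: comp_compl tl_compositions)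
  show "sum_list (incr (comp_compl \<alpha>)) = sum_list (1 # \<alpha>)" by (simp add: comp_compl)
  have "{1..<Suc (sum_list \<alpha>)} - comp_set (1 # \<alpha>) = Suc ` {1..<sum_list \<alpha>} - Suc ` comp_set \<alpha>"
    using sum_list_eq_0_composition[OF assms]
    unfolding comp_set_one_Cons atLeast1_lessThan_Suc by (cases "\<alpha> = []") auto
  then show "comp_set (incr (comp_compl \<alpha>)) = {1..<sum_list (1 # \<alpha>)} - comp_set (1 # \<alpha>)"
    by (simp add: comp_set_incr comp_compl image_set_diff)
qed

lemma comp_compl_incr:
  assumes "\<alpha> \<in> compositions" shows "comp_compl (incr \<alpha>) = 1 # comp_compl \<alpha>"
  using assms comp_compl_one_Cons[of "comp_compl \<alpha>"] comp_compl_involution[of "1 # comp_compl \<alpha>"]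
  by (simp add: comp_compl comp_compl_involution)

lemma comp_compl_image: "comp_compl ` compositions = compositions"
  using comp_compl(1) comp_compl_involution by (auto simp: image_iff) metis

section \<open>Multiplicativity\<close>

text \<open>
  Let \<open>D(t)\<close> be the generating function of the operators \<open>qtail a\<close>, and \<open>E(t)\<close> that of their
  conjugates under \<open>\<Psi>\<close>.  They satisfy \<open>E(t) D(-t) = 1\<close>, the relation between complete and
  elementary symmetric functions.  As \<open>D(-t)\<close> is multiplicative, so is its inverse
  \<open>E(t)\<close>, and multiplicativity of \<open>\<Psi>\<close> follows coefficient by coefficient.\<close>

context
  fixes \<Psi> :: "qsym \<Rightarrow> qsym"
  assumes lin: "Vector_Spaces.linear qscale qscale \<Psi>"
    and compl: "\<forall>\<alpha>\<in>compositions. \<Psi> (qsym_F \<alpha>) = qsym_F (comp_compl \<alpha>)"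
begin

interpretation \<Psi>: Vector_Spaces.linear qscale qscale \<Psi> by (rule lin)

lemma compl_map_involution: "\<Psi> (\<Psi> f) = f"
proof (rule linear_eq_on_fundamental[of qscale "\<lambda>f. \<Psi> (\<Psi> f)" "\<lambda>f. f"])
  show "Vector_Spaces.linear qscale qscale (\<lambda>f. \<Psi> (\<Psi> f))"
    by unfold_locales (simp_all add: \<Psi>.add \<Psi>.scale)
  show "Vector_Spaces.linear qscale qscale (\<lambda>f. f)" by unfold_locales simp_all
qed (simp add: compl comp_compl comp_compl_involution)

lemma compl_map_one: "\<Psi> 1 = 1"
  using bspec[OF compl, of "[]"] by (simp add: qsym_F_Nil)

lemma counit_compl_map: "counit (\<Psi> f) = counit f"
proof (rule linear_eq_on_fundamental[of "(*)" "\<lambda>f. counit (\<Psi> f)" counit])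
  show "Vector_Spaces.linear qscale (*) (\<lambda>f. counit (\<Psi> f))"
    by unfold_locales (simp_all add: counit_def \<Psi>.add \<Psi>.scale algebra_simps)
  show "Vector_Spaces.linear qscale (*) counit" by (rule linear_counit)
  fix \<alpha> :: "nat list" assume a: "\<alpha> \<in> compositions"
  have "comp_compl \<alpha> = [] \<longleftrightarrow> \<alpha> = []"
    using a comp_compl_involution by force
  then show "counit (\<Psi> (qsym_F \<alpha>)) = counit (qsym_F \<alpha>)"
    using a by (simp add: compl counit_def qcoeff_F)
qed

text \<open>
  The coefficient of \<open>t\<^sup>a\<close> in \<open>E(t)\<close>.  Among the fundamental functions of degree at least \<open>a\<close>, where
  \<open>a > 0\<close>, the operator \<open>qtail a\<close> annihilates all but those whose word starts with \<open>a - 1\<close> letters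
  \<open>incr\<close>; this one annihilates all but those whose word starts with \<open>a - 1\<close> parts 1.\<close>

definition conj_qtail :: "nat \<Rightarrow> qsym \<Rightarrow> qsym" where
  "conj_qtail a f = \<Psi> (qtail a (\<Psi> f))"

lemma conj_qtail_0 [simp]: "conj_qtail 0 f = f"
  by (simp add: conj_qtail_def compl_map_involution)

lemma conj_qtail_add: "conj_qtail a (f + g) = conj_qtail a f + conj_qtail a g"
  by (simp add: conj_qtail_def \<Psi>.add qtail_linear)

lemma conj_qtail_scale: "conj_qtail a (qscale c f) = qscale c (conj_qtail a f)"
  by (simp add: conj_qtail_def \<Psi>.scale qtail_linear)

lemma conj_qtail_sum: "conj_qtail a (\<Sum>x\<in>A. f x) = (\<Sum>x\<in>A. conj_qtail a (f x))"
  by (induction A rule: infinite_finite_induct)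
    (use conj_qtail_scale[of a 0 0] in \<open>simp_all add: conj_qtail_add\<close>)

lemma conj_qtail_one: "conj_qtail (Suc j) 1 = 0"
  by (simp add: conj_qtail_def compl_map_one qtail_one \<Psi>.zero)

lemma conj_qtail_F_incr:
  assumes "\<alpha> \<in> compositions"
  shows "conj_qtail (Suc j) (qsym_F (incr \<alpha>)) = (if j = 0 then qsym_F \<alpha> else 0)"
  using assms unfolding conj_qtail_def
  by (simp add: compl tl_compositions comp_compl_incr qtail_F_one[unfolded One_nat_def] comp_compl comp_compl_involution \<Psi>.zero)

lemma conj_qtail_F_one:
  assumes "\<alpha> \<in> compositions"
  shows "conj_qtail (Suc j) (qsym_F (1 # \<alpha>)) = conj_qtail j (qsym_F \<alpha>)"
  using assms unfolding conj_qtail_def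
  by (simp add: compl comp_compl_one_Cons[unfolded One_nat_def] qtail_F_incr comp_compl)

lemma qscale_minus_1: "qscale ((-1) ^ j) f = (-1) ^ j * f"
proof -
  have "qscale (- 1) f = - f" for f
    by (simp add: qsym.scale_minus_left)
  then show ?thesis by (induction j arbitrary: f) (simp_all flip: qsym.scale_scale)
qed

text \<open>The identity \<open>E(t) D(-t) = 1\<close>.  On a word that starts with a part 1 only the terms
  \<open>j = 0\<close> and \<open>j = 1\<close> survive, and they cancel.  On \<open>incr \<alpha>\<close> the terms with \<open>j > 0\<close> form the
  negated sum for \<open>\<alpha>\<close>, and the term \<open>j = 0\<close> compensates it.\<close>

lemma conj_qtail_qtail_alternating:
  "(\<Sum>j\<le>a. (- 1) ^ j * conj_qtail (a - j) (qtail j f)) = (if a = 0 then f else 0)"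
proof -
  let ?G = "\<lambda>a f. \<Sum>j\<le>a. (- 1) ^ j * conj_qtail (a - j) (qtail j f)"
  have lin1: "Vector_Spaces.linear qscale qscale (?G a)" for a
  proof unfold_locales
    show "?G a (f + g) = ?G a f + ?G a g" for f g
      by (simp add: qtail_linear conj_qtail_add algebra_simps sum.distrib)
    show "?G a (qscale c f) = qscale c (?G a f)" for c f
      by (simp add: qtail_linear conj_qtail_scale qsym.scale_sum_right flip: qscale_minus_1)
        (simp add: mult.commute)
  qed
  have lin2: "Vector_Spaces.linear qscale qscale (\<lambda>f. if a = 0 then f else 0)" for a :: nat
    by unfold_locales simp_all
  have "?G a (qsym_F \<alpha>) = (if a = 0 then qsym_F \<alpha> else 0)" if "\<alpha> \<in> compositions" for \<alpha> a
    using that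
  proof (induction \<alpha> arbitrary: a rule: composition_induct)
    case Nil
    show ?case
    proof (cases a)
      case (Suc b)
      have "conj_qtail (Suc b - j) (qtail j 1) = 0" for j
        by (cases j) (use conj_qtail_scale[of _ 0 0] in \<open>simp_all add: qtail_one conj_qtail_one\<close>)
      then show ?thesis using Suc by (simp add: qsym_F_Nil del: sum.atMost_Suc)
    qed simp
  next
    case (one \<alpha>)
    show ?case
    proof (cases a)
      case (Suc b)
      have "?G a (qsym_F (1 # \<alpha>)) = conj_qtail b (qsym_F \<alpha>)
          - (\<Sum>j\<le>b. (- 1) ^ j * conj_qtail (b - j) (if j = 0 then qsym_F \<alpha> else 0))"
        using one unfolding Suc sum.atMost_Suc_shift
        by (simp add: conj_qtail_F_one[unfolded One_nat_def] qtail_F_one[unfolded One_nat_def] sum_negf)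
      also have "(\<Sum>j\<le>b. (- 1) ^ j * conj_qtail (b - j) (if j = 0 then qsym_F \<alpha> else 0))
          = (\<Sum>j\<le>b. if j = 0 then conj_qtail b (qsym_F \<alpha>) else 0)"
        using conj_qtail_scale[of _ 0 0] by (intro sum.cong) auto
      finally show ?thesis using Suc by simp
    qed simp
  next
    case (incr \<alpha>)
    show ?case
    proof (cases a)
      case (Suc b)
      have "?G a (qsym_F (incr \<alpha>)) = (if b = 0 then qsym_F \<alpha> else 0) - ?G b (qsym_F \<alpha>)"
        using incr(1) unfolding Suc sum.atMost_Suc_shift
        by (simp add: conj_qtail_F_incr qtail_F_incr sum_negf)
      then show ?thesis using Suc incr.IH by simp
    qed simp
  qed
  then show ?thesis using linear_eq_on_fundamental[OF lin1 lin2] by blast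
qed

text \<open>Expand the alternating identity for \<open>f * g\<close>.  Replacing \<open>E\<close> of a product
  by the product rule everywhere would turn the sum into the product of the alternating sums for \<open>f\<close>
  and for \<open>g\<close>, whose coefficient at \<open>a > 0\<close> is 0 as well.  By induction the replacement is correct in
  all terms with \<open>j > 0\<close>, hence also in the term \<open>j = 0\<close>, which is the claim.\<close>

lemma conj_qtail_times: "conj_qtail a (f * g) = (\<Sum>i\<le>a. conj_qtail i f * conj_qtail (a - i) g)"
proof (induction a arbitrary: f g rule: less_induct)
  case (less a)
  show ?case
  proof (cases "a = 0")
    case False
    let ?T = "\<lambda>j k l. (- 1) ^ j * (conj_qtail l (qtail k f) * conj_qtail (a - j - l) (qtail (j - k) g))"
    have tail: "(- 1) ^ j * conj_qtail (a - j) (qtail j (f * g)) = (\<Sum>k\<le>j. \<Sum>l\<le>a - j. ?T j k l)"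
      if "j \<in> {1..a}" for j
      using that by (simp add: qtail_times conj_qtail_sum less sum_distrib_left)
    have sign: "(- 1) ^ k * ((- 1) ^ (j - k) * x) = (- 1) ^ j * x" if "k \<le> j" for k j and x :: qsym
      using that by (simp flip: mult.assoc power_add)
    have split: "sum F {..a} = F 0 + sum F {1..a}" for F :: "nat \<Rightarrow> qsym"
      by (simp add: sum.atLeast_Suc_atMost atLeast0AtMost[symmetric])
    have "(\<Sum>j\<le>a. \<Sum>k\<le>j. \<Sum>l\<le>a - j. ?T j k l)
        = (\<Sum>(j, k, l)\<in>Sigma {..a} (\<lambda>j. {..j} \<times> {..a - j}). ?T j k l)"
      by (simp add: sum.Sigma sum.cartesian_product)
    \<comment> \<open>\<open>p\<close> collects the total degree taken from \<open>f\<close>, so the sum splits into a factor for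
      \<open>f\<close> and one for \<open>g\<close>.\<close>
    also have "\<dots> = (\<Sum>(p, k, k')\<in>Sigma {..a} (\<lambda>p. {..p} \<times> {..a - p}).
        ((- 1) ^ k * conj_qtail (p - k) (qtail k f)) * ((- 1) ^ k' * conj_qtail (a - p - k') (qtail k' g)))"
      by (rule sum.reindex_bij_witness[of _ "\<lambda>(p, k, k'). (k + k', k, p - k)" "\<lambda>(j, k, l). (k + l, k, j - k)"])
        (auto simp: algebra_simps sign)
    also have "\<dots> = (\<Sum>p\<le>a. (\<Sum>k\<le>p. (- 1) ^ k * conj_qtail (p - k) (qtail k f))
        * (\<Sum>k\<le>a - p. (- 1) ^ k * conj_qtail (a - p - k) (qtail k g)))"
      by (simp add: sum_product sum.Sigma sum.cartesian_product)
    also have "\<dots> = 0"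
      unfolding conj_qtail_qtail_alternating using False by (intro sum.neutral) auto
    finally have "(\<Sum>i\<le>a. conj_qtail i f * conj_qtail (a - i) g)
        + (\<Sum>j\<in>{1..a}. \<Sum>k\<le>j. \<Sum>l\<le>a - j. ?T j k l) = 0"
      unfolding split[of "\<lambda>j. \<Sum>k\<le>j. \<Sum>l\<le>a - j. ?T j k l"] by simp
    moreover have "(\<Sum>j\<in>{1..a}. (- 1) ^ j * conj_qtail (a - j) (qtail j (f * g)))
        = (\<Sum>j\<in>{1..a}. \<Sum>k\<le>j. \<Sum>l\<le>a - j. ?T j k l)"
      by (rule sum.cong[OF refl tail])
    then have "conj_qtail a (f * g) + (\<Sum>j\<in>{1..a}. \<Sum>k\<le>j. \<Sum>l\<le>a - j. ?T j k l) = 0"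
      using conj_qtail_qtail_alternating[of a "f * g"] False
      unfolding split[of "\<lambda>j. (- 1) ^ j * conj_qtail (a - j) (qtail j (f * g))"] by simp
    ultimately show ?thesis by (simp only: flip: eq_neg_iff_add_eq_0)
  qed simp
qed

text \<open>By construction \<open>qtail i\<close> after \<open>\<Psi>\<close> is \<open>\<Psi>\<close> after \<open>conj_qtail i\<close>, and both operators obey the same
  product rule.  Induction on the list of exponents reduces the claim to constant terms.\<close>

lemma compl_map_times: "\<Psi> (f * g) = \<Psi> f * \<Psi> g"
proof (rule qcoeff_eqI)
  fix \<beta> :: "nat list"
  have tail: "qtail i (\<Psi> f) = \<Psi> (conj_qtail i f)" for i f
    by (simp add: conj_qtail_def compl_map_involution)
  show "qcoeff (\<Psi> (f * g)) \<beta> = qcoeff (\<Psi> f * \<Psi> g) \<beta>"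
  proof (induction \<beta> arbitrary: f g)
    case Nil
    then show ?case using counit_compl_map by (simp add: counit_def qcoeff_times_Nil)
  next
    case (Cons b \<beta>)
    have "qcoeff (\<Psi> (f * g)) (b # \<beta>) = (\<Sum>i\<le>b. qcoeff (\<Psi> (conj_qtail i f * conj_qtail (b - i) g)) \<beta>)"
      by (simp flip: qcoeff_qtail add: tail conj_qtail_times \<Psi>.sum qcoeff_sum)
    also have "\<dots> = qcoeff (qtail b (\<Psi> f * \<Psi> g)) \<beta>"
      by (simp add: Cons qtail_times qcoeff_sum tail)
    finally show ?case by (simp add: qcoeff_qtail)
  qed
qed

end

section \<open>Coefficients of tensors\<close>

text \<open>The coefficient of \<open>M\<^sub>\<beta> \<otimes> M\<^sub>\<gamma>\<close>.  These functionals turn identities between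
  tensors into identities between numbers.\<close>

definition tcoeff :: "nat list \<Rightarrow> nat list \<Rightarrow> qsym_tensor \<Rightarrow> rat" where
  "tcoeff \<beta> \<gamma> = tensor_lift (*) (\<lambda>f g. qcoeff f \<beta> * qcoeff g \<gamma>)"

lemma
  shows linear_tcoeff: "Vector_Spaces.linear tscale (*) (tcoeff \<beta> \<gamma>)"
    and tcoeff_tensor: "tcoeff \<beta> \<gamma> (tensor f g) = qcoeff f \<beta> * qcoeff g \<gamma>"
proof -
  have vs: "vector_space ((*) :: rat \<Rightarrow> rat \<Rightarrow> rat)" by unfold_locales (simp_all add: algebra_simps)
  have 1: "Vector_Spaces.linear qscale (*) (\<lambda>f. qcoeff f \<beta> * qcoeff g \<gamma>)" for g
    by unfold_locales (simp_all add: algebra_simps)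
  have 2: "Vector_Spaces.linear qscale (*) (\<lambda>g. qcoeff f \<beta> * qcoeff g \<gamma>)" for f
    by unfold_locales (simp_all add: algebra_simps)
  show "Vector_Spaces.linear tscale (*) (tcoeff \<beta> \<gamma>)"
    unfolding tcoeff_def using 1 2 by (rule linear_tensor_lift)
  show "tcoeff \<beta> \<gamma> (tensor f g) = qcoeff f \<beta> * qcoeff g \<gamma>"
    unfolding tcoeff_def using 1 2 by (rule tensor_lift_tensor)
qed

interpretation tcoeff: Vector_Spaces.linear tscale "(*)" "tcoeff \<beta> \<gamma>" for \<beta> \<gamma>
  by (rule linear_tcoeff)

text \<open>Deconcatenation is dual to concatenation of indices.\<close>

lemma tcoeff_comult:
  assumes "\<beta> \<in> compositions" "\<gamma> \<in> compositions"
  shows "tcoeff \<beta> \<gamma> (comult f) = qcoeff f (\<beta> @ \<gamma>)"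
proof -
  have app: "\<beta> @ \<gamma> \<in> compositions" using assms by (auto simp: compositions_def)
  have deconcat: "tcoeff \<beta> \<gamma> (deconcat \<alpha>) = (if \<beta> @ \<gamma> = \<alpha> then 1 else 0)"
    if a: "\<alpha> \<in> compositions" for \<alpha>
  proof -
    have "tcoeff \<beta> \<gamma> (deconcat \<alpha>)
        = (\<Sum>x | x \<in> {(\<beta>', \<gamma>'). \<beta>' @ \<gamma>' = \<alpha>}. if (\<beta>, \<gamma>) = x then 1 else 0)"
      unfolding deconcat_def tcoeff.sum mem_Collect_eq Collect_mem_eq
    proof (rule sum.cong[OF refl])
      fix x assume "x \<in> {(\<beta>', \<gamma>'). \<beta>' @ \<gamma>' = \<alpha>}"
      then have "fst x \<in> compositions" "snd x \<in> compositions"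
        using a by (auto simp: compositions_def)
      then show "tcoeff \<beta> \<gamma> (case x of (\<beta>', \<gamma>') \<Rightarrow> tensor (qsym_M \<beta>') (qsym_M \<gamma>'))
          = (if (\<beta>, \<gamma>) = x then 1 else 0)"
        using assms by (auto simp: case_prod_unfold tcoeff_tensor qcoeff_M prod_eq_iff)
    qed
    also have "\<dots> = (if \<beta> @ \<gamma> = \<alpha> then 1 else 0)"
      using finite_deconcat[of \<alpha>] by (subst sum.delta') auto
    finally show ?thesis .
  qed
  have "tcoeff \<beta> \<gamma> (comult f)
      = (\<Sum>\<alpha> | \<alpha> \<in> compositions \<and> qcoeff f \<alpha> \<noteq> 0. if \<beta> @ \<gamma> = \<alpha> then qcoeff f \<alpha> else 0)"
    unfolding comult_def tcoeff.sum
    by (intro sum.cong) (auto simp: tcoeff.scale deconcat)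
  also have "\<dots> = qcoeff f (\<beta> @ \<gamma>)"
    using finite_qcoeff[of f] app by (subst sum.delta') auto
  finally show ?thesis .
qed

lemma qsym_M_expansion_finite:
  assumes "finite K" "K \<subseteq> compositions" "{\<alpha> \<in> compositions. qcoeff f \<alpha> \<noteq> 0} \<subseteq> K"
  shows "f = (\<Sum>\<alpha>\<in>K. qscale (qcoeff f \<alpha>) (qsym_M \<alpha>))"
  using assms by (subst qsym_M_expansion, intro sum.mono_neutral_left) auto

lemma tensor_sum: "tensor (\<Sum>x\<in>A. f x) (\<Sum>y\<in>B. g y) = (\<Sum>x\<in>A. \<Sum>y\<in>B. tensor (f x) (g y))"
proof -
  have zero: "tensor 0 g = 0" "tensor f 0 = 0" for f g
    using tensor_bilinear(3)[of 0 0 g] tensor_bilinear(4)[of f 0 0] by simp_all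
  have "tensor f (\<Sum>y\<in>B. g y) = (\<Sum>y\<in>B. tensor f (g y))" for f
    by (induction B rule: infinite_finite_induct) (simp_all add: zero tensor_bilinear)
  then show ?thesis
    by (induction A rule: infinite_finite_induct) (simp_all add: zero tensor_bilinear sum.distrib)
qed

text \<open>A sum of pure tensors involves finitely many compositions \<open>K\<close>, so it is recovered from its
  coefficients at pairs from \<open>K\<close>, or from any larger finite set.  A common larger set serves both
  tensors.\<close>

lemma tensor_eqI:
  assumes T: "T \<in> tensor.span {tensor f g | f g. True}" and U: "U \<in> tensor.span {tensor f g | f g. True}"
    and eq: "\<And>\<beta> \<gamma>. \<beta> \<in> compositions \<Longrightarrow> \<gamma> \<in> compositions \<Longrightarrow> tcoeff \<beta> \<gamma> T = tcoeff \<beta> \<gamma> U"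
  shows "T = U"
proof -
  let ?R = "\<lambda>K T. \<Sum>\<beta>\<in>K. \<Sum>\<gamma>\<in>K. tscale (tcoeff \<beta> \<gamma> T) (tensor (qsym_M \<beta>) (qsym_M \<gamma>))"
  define expands where "expands T K \<longleftrightarrow> T = ?R K T" for T K
  have expansion: "\<exists>K0. finite K0 \<and> K0 \<subseteq> compositions \<and>
      (\<forall>K. finite K \<longrightarrow> K0 \<subseteq> K \<longrightarrow> K \<subseteq> compositions \<longrightarrow> expands T K)"
    if "T \<in> tensor.span {tensor f g | f g. True}" for T
    using that
  proof (induction rule: tensor.span_induct_alt)
    case base
    show ?case by (intro exI[of _ "{}"]) (simp add: expands_def tcoeff.zero)
  next
    case (step c x T)
    then obtain K1 where K1: "finite K1" "K1 \<subseteq> compositions"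
      "\<And>K. finite K \<Longrightarrow> K1 \<subseteq> K \<Longrightarrow> K \<subseteq> compositions \<Longrightarrow> expands T K" by blast
    obtain f g where x: "x = tensor f g" using step by blast
    let ?F = "{\<alpha> \<in> compositions. qcoeff f \<alpha> \<noteq> 0} \<union> {\<alpha> \<in> compositions. qcoeff g \<alpha> \<noteq> 0}"
    have "expands (tscale c x + T) K"
      if K: "finite K" "?F \<union> K1 \<subseteq> K" "K \<subseteq> compositions" for K
    proof -
      have "f = (\<Sum>\<alpha>\<in>K. qscale (qcoeff f \<alpha>) (qsym_M \<alpha>))" "g = (\<Sum>\<alpha>\<in>K. qscale (qcoeff g \<alpha>) (qsym_M \<alpha>))"
        using K by (intro qsym_M_expansion_finite; blast)+
      then have "x = tensor (\<Sum>\<alpha>\<in>K. qscale (qcoeff f \<alpha>) (qsym_M \<alpha>)) (\<Sum>\<alpha>\<in>K. qscale (qcoeff g \<alpha>) (qsym_M \<alpha>))"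
        unfolding x by simp
      also have "\<dots> = ?R K x"
        by (simp add: tensor_sum tensor_bilinear x tcoeff_tensor mult.commute)
      finally have x': "x = ?R K x" .
      have T': "T = ?R K T" using K1(3)[of K] K by (simp add: expands_def)
      have "?R K (tscale c x + T) = tscale c (?R K x) + ?R K T"
        by (simp add: tcoeff.add tcoeff.scale tensor.scale_left_distrib sum.distrib tensor.scale_sum_right)
      then show ?thesis using x' T' by (simp add: expands_def)
    qed
    moreover have "finite (?F \<union> K1)" "?F \<union> K1 \<subseteq> compositions"
      using K1 finite_qcoeff by auto
    ultimately show ?case by (intro exI[of _ "?F \<union> K1"] conjI allI impI)
  qed
  obtain K where K: "finite K" "K \<subseteq> compositions"
    "\<And>N. finite N \<Longrightarrow> K \<subseteq> N \<Longrightarrow> N \<subseteq> compositions \<Longrightarrow> expands T N"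
    using expansion[OF T] by blast
  obtain L where L: "finite L" "L \<subseteq> compositions"
    "\<And>N. finite N \<Longrightarrow> L \<subseteq> N \<Longrightarrow> N \<subseteq> compositions \<Longrightarrow> expands U N"
    using expansion[OF U] by blast
  have "expands T (K \<union> L)" "expands U (K \<union> L)"
    using K(1,2) L(1,2) by (auto intro!: K(3) L(3))
  moreover have "?R (K \<union> L) T = ?R (K \<union> L) U"
    using K(2) L(2) by (intro sum.cong refl) (simp add: eq subsetD[OF Un_least[OF K(2) L(2)]])
  ultimately show ?thesis unfolding expands_def by (elim ssubst) (rule refl)
qed

section \<open>The coproduct on the fundamental basis\<close>

text \<open>
  The ways to cut the word of \<open>\<alpha>\<close>, one for each degree of the left piece, with the letter at
  the cut forgotten.  The equation for a zero part is a default for lists that are not compositions.\<close>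

fun cuts :: "nat list \<Rightarrow> (nat list \<times> nat list) list" where
  "cuts [] = [([], [])]"
| "cuts (0 # \<alpha>) = []"
| "cuts (Suc 0 # \<alpha>) = ([], 1 # \<alpha>) # map (apfst ((#) 1)) (cuts \<alpha>)"
| "cuts (Suc (Suc a) # \<alpha>) = ([], Suc (Suc a) # \<alpha>) # map (apfst incr) (cuts (Suc a # \<alpha>))"

lemma cuts_one: "cuts (1 # \<alpha>) = ([], 1 # \<alpha>) # map (apfst ((#) 1)) (cuts \<alpha>)"
  by simp

lemma cuts_incr:
  assumes "\<alpha> \<in> compositions"
  shows "cuts (incr \<alpha>) = ([], incr \<alpha>) # map (apfst incr) (cuts \<alpha>)"
proof (cases \<alpha>)
  case (Cons a \<beta>)
  then show ?thesis using assms by (cases a) auto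
qed simp

lemma cuts_compositions:
  assumes "\<alpha> \<in> compositions" "(x, y) \<in> set (cuts \<alpha>)"
  shows "x \<in> compositions \<and> y \<in> compositions \<and> sum_list x + sum_list y = sum_list \<alpha>"
  using assms
proof (induction \<alpha> arbitrary: x y rule: composition_induct)
  case (one \<alpha>)
  then show ?case by (auto simp: cuts_one simp del: cuts.simps One_nat_def)
next
  case (incr \<alpha>)
  then show ?case by (fastforce simp: cuts_incr tl_compositions)
qed simp

text \<open>Exchanging the two letters commutes with cutting the word.\<close>

lemma cuts_comp_compl:
  assumes "\<alpha> \<in> compositions"
  shows "cuts (comp_compl \<alpha>) = map (map_prod comp_compl comp_compl) (cuts \<alpha>)"
  using assms
proof (induction \<alpha> rule: composition_induct)
  case (one \<alpha>)
  then show ?case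
    using cuts_compositions[OF one(1)]
    by (auto simp: comp_compl_one_Cons cuts_one cuts_incr comp_compl simp del: cuts.simps One_nat_def)
next
  case (incr \<alpha>)
  then show ?case
    using cuts_compositions[OF incr(1)]
    by (auto simp: comp_compl_incr cuts_one cuts_incr comp_compl simp del: cuts.simps One_nat_def)
qed simp

text \<open>Strip the left list \<open>\<beta>\<close> and the left pieces of the cuts in parallel.  For nonempty \<open>\<beta>\<close> the
  cut with empty left piece contributes 0, and the other cuts reduce to those of a shorter word.\<close>

lemma qcoeff_F_append:
  assumes "\<alpha> \<in> compositions" "\<beta> \<in> compositions" "\<gamma> \<in> compositions"
  shows "qcoeff (qsym_F \<alpha>) (\<beta> @ \<gamma>) = (\<Sum>(x, y)\<leftarrow>cuts \<alpha>. qcoeff (qsym_F x) \<beta> * qcoeff (qsym_F y) \<gamma>)"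
  using assms(1,2)
proof (induction \<alpha> arbitrary: \<beta> rule: composition_induct)
  case Nil
  then show ?case using assms(3) by (simp add: qcoeff_F compositions_def)
next
  case (one \<alpha>)
  show ?case
  proof (cases \<beta>)
    case Nil
    then show ?thesis
      by (simp add: cuts_one qcoeff_F case_prod_unfold comp_def del: cuts.simps One_nat_def)
  next
    case (Cons b \<delta>)
    then obtain j where \<beta>: "\<beta> = Suc j # \<delta>" "\<delta> \<in> compositions" using one by (cases b) auto
    have F: "qcoeff (qsym_F (1 # x)) (Suc j # w) = (if j = 0 then qcoeff (qsym_F x) w else 0)" for x w
      by (simp flip: qcoeff_qtail add: qtail_F_one del: One_nat_def)
    have "qcoeff (qsym_F []) (Suc j # \<delta>) = 0" using \<beta>(2) by (simp add: qcoeff_F)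
    then show ?thesis
      using one.IH[OF \<beta>(2)] \<beta>
      by (simp add: F cuts_one case_prod_unfold comp_def del: cuts.simps One_nat_def)
  qed
next
  case (incr \<alpha>)
  have nonempty: "incr x \<noteq> []" for x by (cases x) auto
  show ?case
  proof (cases \<beta>)
    case Nil
    then show ?thesis
      using incr.hyps by (simp add: cuts_incr qcoeff_F nonempty case_prod_unfold comp_def del: cuts.simps)
  next
    case (Cons b \<delta>)
    then obtain j where \<beta>: "\<beta> = Suc j # \<delta>" "\<delta> \<in> compositions" using incr by (cases b) auto
    define \<beta>' where "\<beta>' = (if j = 0 then \<delta> else j # \<delta>)"
    have \<beta>': "\<beta>' \<in> compositions" using \<beta> by (simp add: \<beta>'_def)
    have F: "qcoeff (qsym_F (incr x)) (Suc j # \<delta> @ w) = qcoeff (qsym_F x) (\<beta>' @ w)"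
      if "x \<in> compositions" for x w
    proof -
      have "qcoeff (qsym_F (incr x)) (Suc j # \<delta> @ w) = qcoeff (qtail j (qsym_F x)) (\<delta> @ w)"
        using that by (simp flip: qcoeff_qtail add: qtail_F_incr)
      then show ?thesis by (cases "j = 0") (simp_all add: \<beta>'_def qcoeff_qtail)
    qed
    have "qcoeff (qsym_F (incr \<alpha>)) (\<beta> @ \<gamma>)
        = (\<Sum>(x, y)\<leftarrow>cuts \<alpha>. qcoeff (qsym_F x) \<beta>' * qcoeff (qsym_F y) \<gamma>)"
      using incr.IH[OF \<beta>'] \<beta> F[OF incr.hyps] by simp
    also have "\<dots> = (\<Sum>(x, y)\<leftarrow>cuts \<alpha>. qcoeff (qsym_F (incr x)) \<beta> * qcoeff (qsym_F y) \<gamma>)"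
      using F[where w = "[]"] cuts_compositions[OF incr.hyps] \<beta>
      by (intro arg_cong[where f = sum_list] map_cong refl) auto
    finally have "qcoeff (qsym_F (incr \<alpha>)) (\<beta> @ \<gamma>)
        = (\<Sum>(x, y)\<leftarrow>cuts \<alpha>. qcoeff (qsym_F (incr x)) \<beta> * qcoeff (qsym_F y) \<gamma>)" .
    moreover have "qcoeff (qsym_F []) \<beta> = 0" using \<beta> by (simp add: qcoeff_F)
    from this have "(\<Sum>(x, y)\<leftarrow>cuts \<alpha>. qcoeff (qsym_F (incr x)) \<beta> * qcoeff (qsym_F y) \<gamma>)
        = (\<Sum>(x, y)\<leftarrow>cuts (incr \<alpha>). qcoeff (qsym_F x) \<beta> * qcoeff (qsym_F y) \<gamma>)"
      using incr.hyps by (simp add: cuts_incr case_prod_unfold comp_def del: cuts.simps)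
    ultimately show ?thesis by simp
  qed
qed

interpretation comult: Vector_Spaces.linear qscale tscale comult
  by (rule linear_comult)

lemma tcoeff_sum_list: "tcoeff \<beta> \<gamma> (\<Sum>x\<leftarrow>xs. T x) = (\<Sum>x\<leftarrow>xs. tcoeff \<beta> \<gamma> (T x))"
  by (induction xs) (simp_all add: tcoeff.zero tcoeff.add)

text \<open>With the cut after degree \<open>i\<close> written as \<open>(x, y)\<close>, the component of the coproduct of
  \<open>F\<^sub>\<alpha>\<close> in degrees \<open>(i, n - i)\<close> is the single tensor \<open>F\<^sub>x \<otimes> F\<^sub>y\<close>.\<close>

lemma comult_F:
  assumes "\<alpha> \<in> compositions"
  shows "comult (qsym_F \<alpha>) = (\<Sum>(x, y)\<leftarrow>cuts \<alpha>. tensor (qsym_F x) (qsym_F y))"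
proof (rule tensor_eqI)
  have base: "tensor f g \<in> tensor.span {tensor f g | f g. True}" for f g
    by (rule tensor.span_base) blast
  show "comult (qsym_F \<alpha>) \<in> tensor.span {tensor f g | f g. True}"
    unfolding comult_def deconcat_def case_prod_unfold
    by (intro tensor.span_sum tensor.span_scale base)
  have "(\<Sum>(x, y)\<leftarrow>xs. tensor (qsym_F x) (qsym_F y)) \<in> tensor.span {tensor f g | f g. True}" for xs
  proof (induction xs)
    case (Cons p xs)
    then show ?case
      using tensor.span_add[OF base[of "qsym_F (fst p)" "qsym_F (snd p)"] Cons]
      by (simp add: case_prod_unfold)
  qed (simp add: tensor.span_zero)
  then show "(\<Sum>(x, y)\<leftarrow>cuts \<alpha>. tensor (qsym_F x) (qsym_F y)) \<in> tensor.span {tensor f g | f g. True}" .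
  fix \<beta> \<gamma> :: "nat list" assume *: "\<beta> \<in> compositions" "\<gamma> \<in> compositions"
  show "tcoeff \<beta> \<gamma> (comult (qsym_F \<alpha>)) = tcoeff \<beta> \<gamma> (\<Sum>(x, y)\<leftarrow>cuts \<alpha>. tensor (qsym_F x) (qsym_F y))"
    unfolding tcoeff_comult[OF *] tcoeff_sum_list qcoeff_F_append[OF assms *]
    by (simp add: case_prod_unfold tcoeff_tensor)
qed

lemma tensor_map_comult_F:
  assumes "Vector_Spaces.linear qscale qscale \<phi>" "\<alpha> \<in> compositions"
  shows "tensor_map \<phi> \<phi> (comult (qsym_F \<alpha>)) = (\<Sum>(x, y)\<leftarrow>cuts \<alpha>. tensor (\<phi> (qsym_F x)) (\<phi> (qsym_F y)))"
proof -
  interpret m: Vector_Spaces.linear tscale tscale "tensor_map \<phi> \<phi>"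
    using assms(1) by (intro linear_tensor_map)
  have "tensor_map \<phi> \<phi> (\<Sum>x\<leftarrow>xs. T x) = (\<Sum>x\<leftarrow>xs. tensor_map \<phi> \<phi> (T x))" for T and xs :: "(nat list \<times> nat list) list"
    by (induction xs) (simp_all add: m.zero m.add)
  then show ?thesis
    by (simp add: comult_F[OF assms(2)] case_prod_unfold tensor_map_tensor[OF assms(1) assms(1)])
qed

lemma comult_compl_map:
  assumes lin: "Vector_Spaces.linear qscale qscale \<Psi>"
    and compl: "\<forall>\<alpha>\<in>compositions. \<Psi> (qsym_F \<alpha>) = qsym_F (comp_compl \<alpha>)"
  shows "comult (\<Psi> f) = tensor_map \<Psi> \<Psi> (comult f)"
proof (rule linear_eq_on_fundamental[of tscale "\<lambda>f. comult (\<Psi> f)" "\<lambda>f. tensor_map \<Psi> \<Psi> (comult f)"])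
  interpret \<Psi>: Vector_Spaces.linear qscale qscale \<Psi> by fact
  interpret m: Vector_Spaces.linear tscale tscale "tensor_map \<Psi> \<Psi>"
    using lin by (intro linear_tensor_map)
  show "Vector_Spaces.linear qscale tscale (\<lambda>f. comult (\<Psi> f))"
    by unfold_locales (simp_all add: \<Psi>.add \<Psi>.scale comult.add comult.scale)
  show "Vector_Spaces.linear qscale tscale (\<lambda>f. tensor_map \<Psi> \<Psi> (comult f))"
    by unfold_locales (simp_all add: m.add m.scale comult.add comult.scale)
  fix \<alpha> :: "nat list" assume a: "\<alpha> \<in> compositions"
  have "comult (\<Psi> (qsym_F \<alpha>)) = (\<Sum>(x, y)\<leftarrow>cuts \<alpha>. tensor (qsym_F (comp_compl x)) (qsym_F (comp_compl y)))"
    using a by (simp add: compl comult_F comp_compl cuts_comp_compl case_prod_unfold comp_def)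
  also have "\<dots> = tensor_map \<Psi> \<Psi> (comult (qsym_F \<alpha>))"
    unfolding tensor_map_comult_F[OF lin a] using cuts_compositions[OF a] compl
    by (intro arg_cong[where f = sum_list] map_cong refl) auto
  finally show "comult (\<Psi> (qsym_F \<alpha>)) = tensor_map \<Psi> \<Psi> (comult (qsym_F \<alpha>))" .
qed

section \<open>The grading\<close>

lemma qsym_deg_iff:
  "f \<in> qsym_deg n \<longleftrightarrow> (\<forall>\<alpha>\<in>compositions. qcoeff f \<alpha> \<noteq> 0 \<longrightarrow> sum_list \<alpha> = n)"
proof
  assume "f \<in> qsym_deg n"
  then show "\<forall>\<alpha>\<in>compositions. qcoeff f \<alpha> \<noteq> 0 \<longrightarrow> sum_list \<alpha> = n"
    unfolding qsym_deg_def
  proof (induction rule: qsym.span_induct_alt)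
    case (step c x f)
    then obtain \<beta> where "\<beta> \<in> compositions" "sum_list \<beta> = n" "x = qsym_M \<beta>" by blast
    then show ?case using step.IH by (auto simp: qcoeff_M)
  qed simp
next
  assume supp: "\<forall>\<alpha>\<in>compositions. qcoeff f \<alpha> \<noteq> 0 \<longrightarrow> sum_list \<alpha> = n"
  have "(\<Sum>\<alpha> | \<alpha> \<in> compositions \<and> qcoeff f \<alpha> \<noteq> 0. qscale (qcoeff f \<alpha>) (qsym_M \<alpha>)) \<in> qsym_deg n"
    unfolding qsym_deg_def using supp by (intro qsym.span_sum qsym.span_scale qsym.span_base) auto
  then show "f \<in> qsym_deg n" unfolding qsym_M_expansion[symmetric] .
qed

lemma qsym_F_deg: "qsym_F \<alpha> \<in> qsym_deg (sum_list \<alpha>)"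
  using refines_sum by (auto simp: qsym_deg_iff qcoeff_F)

definition deg_part :: "nat \<Rightarrow> qsym \<Rightarrow> qsym" where
  "deg_part n f = (\<Sum>\<alpha> | \<alpha> \<in> compositions \<and> sum_list \<alpha> = n. qscale (qcoeff f \<alpha>) (qsym_M \<alpha>))"

lemma qcoeff_deg_part:
  assumes "\<beta> \<in> compositions"
  shows "qcoeff (deg_part n f) \<beta> = (if sum_list \<beta> = n then qcoeff f \<beta> else 0)"
proof -
  have "qcoeff (deg_part n f) \<beta> = (\<Sum>\<alpha> | \<alpha> \<in> compositions \<and> sum_list \<alpha> = n. if \<beta> = \<alpha> then qcoeff f \<alpha> else 0)"
    unfolding deg_part_def qcoeff_sum using assms by (intro sum.cong) (auto simp: qcoeff_M)
  then show ?thesis using finite_compositions[of n] assms by (simp add: sum.delta')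
qed

lemma linear_deg_part: "Vector_Spaces.linear qscale qscale (deg_part n)"
  by unfold_locales (rule qcoeff_eqI, simp add: qcoeff_deg_part)+

lemma qsym_deg_iff_deg_part: "f \<in> qsym_deg n \<longleftrightarrow> deg_part n f = f"
proof
  assume "f \<in> qsym_deg n"
  then show "deg_part n f = f"
    by (intro qcoeff_eqI) (auto simp: qcoeff_deg_part qsym_deg_iff)
next
  assume eq: "deg_part n f = f"
  show "f \<in> qsym_deg n"
    unfolding qsym_deg_iff by (subst eq[symmetric]) (simp add: qcoeff_deg_part)
qed

lemma deg_part_F: "deg_part n (qsym_F \<alpha>) = (if sum_list \<alpha> = n then qsym_F \<alpha> else 0)"
  using refines_sum by (intro qcoeff_eqI) (auto simp: qcoeff_deg_part qcoeff_F)

text \<open>It is enough that \<open>\<Psi>\<close> commutes with the projections to the homogeneous components, and this can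
  be checked on the fundamental basis.\<close>

lemma graded_compl_map:
  assumes lin: "Vector_Spaces.linear qscale qscale \<Psi>"
    and compl: "\<forall>\<alpha>\<in>compositions. \<Psi> (qsym_F \<alpha>) = qsym_F (comp_compl \<alpha>)"
  shows "graded \<Psi>"
proof -
  interpret \<Psi>: Vector_Spaces.linear qscale qscale \<Psi> by fact
  interpret d: Vector_Spaces.linear qscale qscale "deg_part n" for n by (rule linear_deg_part)
  have "deg_part n (\<Psi> f) = \<Psi> (deg_part n f)" for n f
  proof (rule linear_eq_on_fundamental[of qscale "\<lambda>f. deg_part n (\<Psi> f)" "\<lambda>f. \<Psi> (deg_part n f)"])
    show "Vector_Spaces.linear qscale qscale (\<lambda>f. deg_part n (\<Psi> f))"
      "Vector_Spaces.linear qscale qscale (\<lambda>f. \<Psi> (deg_part n f))"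
      by (unfold_locales; simp add: \<Psi>.add \<Psi>.scale d.add d.scale)+
  qed (simp add: compl deg_part_F comp_compl \<Psi>.zero)
  then show ?thesis by (auto simp: graded_def qsym_deg_iff_deg_part)
qed

section \<open>Uniqueness\<close>

lemma refines_single: "\<delta> \<noteq> [] \<Longrightarrow> refines \<delta> [sum_list \<delta>]"
  by (rule refinesI[of "[\<delta>]"]) auto

lemma refines_antisym: "refines \<alpha> \<beta> \<Longrightarrow> refines \<beta> \<alpha> \<Longrightarrow> \<alpha> = \<beta>"
  using refines_length by (metis le_antisym)

text \<open>Two compositions with at least two parts refine each other, by taking \<open>\<delta>\<close> to be either of them.
  If one of them is \<open>[n]\<close>, then the other is refined by both \<open>[1, n - 1]\<close> and \<open>[n - 1, 1]\<close>, which
  forces it to be \<open>[n]\<close> as soon as these two differ; hence the bound \<open>n \<ge> 3\<close>.\<close>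

lemma composition_determined_by_long_refinements:
  assumes \<alpha>: "\<alpha> \<in> compositions" "sum_list \<alpha> = n" and \<beta>: "\<beta> \<in> compositions" "sum_list \<beta> = n"
    and n: "n \<ge> 3"
    and eq: "\<And>\<delta>. \<delta> \<in> compositions \<Longrightarrow> length \<delta> \<ge> 2 \<Longrightarrow> refines \<delta> \<alpha> \<longleftrightarrow> refines \<delta> \<beta>"
  shows "\<alpha> = \<beta>"
proof -
  have short: "\<gamma> = [n]" if "length \<gamma> < 2" "sum_list \<gamma> = n" for \<gamma>
    using that n by (cases \<gamma>) auto
  have all: "length \<gamma> < 2"
    if "\<gamma> \<in> compositions" "\<And>\<delta>. \<delta> \<in> compositions \<Longrightarrow> length \<delta> \<ge> 2 \<Longrightarrow> refines \<delta> [n] \<Longrightarrow> refines \<delta> \<gamma>" for \<gamma>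
  proof (rule ccontr)
    assume "\<not> length \<gamma> < 2"
    moreover have "refines [1, n - 1] \<gamma>" "refines [n - 1, 1] \<gamma>"
      using n refines_single[of "[1, n - 1]"] refines_single[of "[n - 1, 1]"] by (auto intro!: that(2))
    ultimately have "\<gamma> = [1, n - 1]" "\<gamma> = [n - 1, 1]"
      using refines_length[of "[1, n - 1]" \<gamma>] refines_length[of "[n - 1, 1]" \<gamma>] by auto
    then have "[1, n - 1] = [n - 1, 1]" by simp
    then have "n - 1 = 1" by simp
    then show False using n by simp
  qed
  show ?thesis
  proof (cases "length \<alpha> < 2 \<or> length \<beta> < 2")
    case True
    then have "\<alpha> = [n] \<or> \<beta> = [n]" using short \<alpha> \<beta> by blast
    then have "length \<alpha> < 2 \<and> length \<beta> < 2" using all[of \<alpha>] all[of \<beta>] \<alpha> \<beta> eq by auto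
    then show ?thesis using short \<alpha> \<beta> by metis
  next
    case False
    have "refines \<alpha> \<alpha>" "refines \<beta> \<beta>" using \<alpha> \<beta> by (auto intro: refines_refl simp: compositions_def)
    then show ?thesis using eq[of \<alpha>] eq[of \<beta>] False \<alpha> \<beta> by (auto intro: refines_antisym)
  qed
qed

lemma graded_map_F:
  assumes "graded \<phi>" "\<phi> ` qsym_F ` compositions \<subseteq> qsym_F ` compositions" "\<alpha> \<in> compositions"
  obtains \<beta> where "\<beta> \<in> compositions" "sum_list \<beta> = sum_list \<alpha>" "\<phi> (qsym_F \<alpha>) = qsym_F \<beta>"
proof -
  obtain \<beta> where \<beta>: "\<beta> \<in> compositions" "\<phi> (qsym_F \<alpha>) = qsym_F \<beta>" using assms by blast
  then have "qsym_F \<beta> \<in> qsym_deg (sum_list \<alpha>)"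
    using assms(1) qsym_F_deg[of \<alpha>] unfolding graded_def by (metis image_subset_iff)
  then have "sum_list \<beta> = sum_list \<alpha>"
    using \<beta>(1) refines_refl[of \<beta>] by (auto simp: qsym_deg_iff qcoeff_F compositions_def)
  then show ?thesis using that \<beta> by blast
qed

text \<open>From degree 3 on, a graded coalgebra map that takes fundamental functions to such is determined by
  its values in lower degrees: the coefficients of \<open>\<phi>(F\<^sub>\<alpha>)\<close> at lists with at least two parts are
  coefficients of its coproduct, which only involve smaller degrees.  These
  coefficients identify a fundamental function among all of its degree.  In degrees 0 and 1 there is only
  one choice, so everything depends on degree 2.\<close>

lemma graded_coalgebra_map_eqI:
  assumes lin: "Vector_Spaces.linear qscale qscale \<phi>" "Vector_Spaces.linear qscale qscale \<psi>"
    and comult: "\<And>\<alpha>. \<alpha> \<in> compositions \<Longrightarrow>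
        comult (\<phi> (qsym_F \<alpha>)) = (\<Sum>(x, y)\<leftarrow>cuts \<alpha>. tensor (\<phi> (qsym_F x)) (\<phi> (qsym_F y)))"
      "\<And>\<alpha>. \<alpha> \<in> compositions \<Longrightarrow>
        comult (\<psi> (qsym_F \<alpha>)) = (\<Sum>(x, y)\<leftarrow>cuts \<alpha>. tensor (\<psi> (qsym_F x)) (\<psi> (qsym_F y)))"
    and graded: "graded \<phi>" "graded \<psi>"
    and image: "\<phi> ` qsym_F ` compositions \<subseteq> qsym_F ` compositions"
      "\<psi> ` qsym_F ` compositions \<subseteq> qsym_F ` compositions"
    and two: "\<And>\<alpha>. \<alpha> \<in> compositions \<Longrightarrow> sum_list \<alpha> = 2 \<Longrightarrow> \<phi> (qsym_F \<alpha>) = \<psi> (qsym_F \<alpha>)"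
  shows "\<phi> = \<psi>"
proof -
  have "\<alpha> \<in> compositions \<Longrightarrow> \<phi> (qsym_F \<alpha>) = \<psi> (qsym_F \<alpha>)" for \<alpha>
  proof (induction "sum_list \<alpha>" arbitrary: \<alpha> rule: less_induct)
    case less
    define n where "n = sum_list \<alpha>"
    obtain \<beta> where \<beta>: "\<beta> \<in> compositions" "sum_list \<beta> = n" "\<phi> (qsym_F \<alpha>) = qsym_F \<beta>"
      using graded_map_F[OF graded(1) image(1) less.prems] n_def by blast
    obtain \<gamma> where \<gamma>: "\<gamma> \<in> compositions" "sum_list \<gamma> = n" "\<psi> (qsym_F \<alpha>) = qsym_F \<gamma>"
      using graded_map_F[OF graded(2) image(2) less.prems] n_def by blast
    consider "n < 2" | "n = 2" | "n \<ge> 3" by linarith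
    then show ?case
    proof cases
      case 1
      have "\<delta> = \<epsilon>" if "\<delta> \<in> compositions" "\<epsilon> \<in> compositions" "sum_list \<delta> = n" "sum_list \<epsilon> = n" for \<delta> \<epsilon>
        using that 1 comp_set_subset[of \<delta>] comp_set_subset[of \<epsilon>] by (intro comp_set_inj) auto
      then show ?thesis using \<beta> \<gamma> by metis
    next
      case 2
      then show ?thesis using two less.prems n_def by simp
    next
      case 3
      have "\<beta> = \<gamma>"
      proof (rule composition_determined_by_long_refinements[OF \<beta>(1,2) \<gamma>(1,2) 3])
        \<comment> \<open>Split \<open>\<delta>\<close> after its first part; both pieces have degree below \<open>n\<close>.\<close>
        fix \<delta> :: "nat list" assume \<delta>: "\<delta> \<in> compositions" "length \<delta> \<ge> 2"
        then obtain d \<delta>' where d: "\<delta> = [d] @ \<delta>'" "[d] \<in> compositions" "\<delta>' \<in> compositions" "\<delta>' \<noteq> []"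
          by (cases \<delta>; cases "tl \<delta>") simp_all
        show "refines \<delta> \<beta> \<longleftrightarrow> refines \<delta> \<gamma>"
        proof (cases "sum_list \<delta> = n")
          case False
          then show ?thesis using refines_sum[of \<delta>] \<beta> \<gamma> by auto
        next
          case True
          have "sum_list \<delta>' \<noteq> 0" using d sum_list_eq_0_composition by blast
          moreover have "d + sum_list \<delta>' = n" "d \<noteq> 0" using True d(1,2) by simp_all
          ultimately have pos: "d < n" "sum_list \<delta>' < n" by linarith+
          have high: "qcoeff (\<chi> (qsym_F x)) w = 0"
            if "graded \<chi>" "w \<in> compositions" "sum_list w < sum_list x" for \<chi> x w
          proof -
            have "\<chi> (qsym_F x) \<in> qsym_deg (sum_list x)"
              using that(1) qsym_F_deg[of x] unfolding graded_def by blast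
            then show ?thesis using that(2,3) unfolding qsym_deg_iff by force
          qed
          have summand: "qcoeff (\<phi> (qsym_F x)) [d] * qcoeff (\<phi> (qsym_F y)) \<delta>'
              = qcoeff (\<psi> (qsym_F x)) [d] * qcoeff (\<psi> (qsym_F y)) \<delta>'" if "(x, y) \<in> set (cuts \<alpha>)" for x y
          proof -
            have xy: "x \<in> compositions" "y \<in> compositions" "sum_list x + sum_list y = n"
              using cuts_compositions[OF less.prems that] n_def by auto
            then consider "sum_list x < n" "sum_list y < n" | "sum_list x = n" | "sum_list y = n"
              by linarith
            then show ?thesis
            proof cases
              case 1
              then show ?thesis using xy less.hyps n_def by simp
            next
              case 2
              then show ?thesis using high[OF graded(1) d(2), of x] high[OF graded(2) d(2), of x] pos by simp
            next
              case 3
              then show ?thesis using high[OF graded(1) d(3), of y] high[OF graded(2) d(3), of y] pos by simp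
            qed
          qed
          have "qcoeff (qsym_F \<beta>) \<delta> = (\<Sum>(x, y)\<leftarrow>cuts \<alpha>. qcoeff (\<phi> (qsym_F x)) [d] * qcoeff (\<phi> (qsym_F y)) \<delta>')"
            using tcoeff_comult[OF d(2,3), of "\<phi> (qsym_F \<alpha>)"]
            unfolding comult(1)[OF less.prems] unfolding \<beta>(3)
            by (simp add: tcoeff_sum_list case_prod_unfold tcoeff_tensor d(1))
          also have "\<dots> = (\<Sum>(x, y)\<leftarrow>cuts \<alpha>. qcoeff (\<psi> (qsym_F x)) [d] * qcoeff (\<psi> (qsym_F y)) \<delta>')"
            using summand by (intro arg_cong[where f = sum_list] map_cong refl) auto
          also have "\<dots> = qcoeff (qsym_F \<gamma>) \<delta>"
            using tcoeff_comult[OF d(2,3), of "\<psi> (qsym_F \<alpha>)"]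
            unfolding comult(2)[OF less.prems] unfolding \<gamma>(3)
            by (simp add: tcoeff_sum_list case_prod_unfold tcoeff_tensor d(1))
          finally show ?thesis using \<delta>(1) by (auto simp: qcoeff_F split: if_splits)
        qed
      qed
      then show ?thesis using \<beta> \<gamma> by simp
    qed
  qed
  then show ?thesis using linear_eq_on_fundamental[OF lin] by blast
qed

lemma compositions_of_2: "\<alpha> \<in> compositions \<Longrightarrow> sum_list \<alpha> = 2 \<Longrightarrow> \<alpha> = [2] \<or> \<alpha> = [1, 1]"
proof (cases \<alpha> rule: remdups_adj.cases)
  case (3 x y xs)
  assume "\<alpha> \<in> compositions" "sum_list \<alpha> = 2"
  then have "x + (y + sum_list xs) = 2" "x \<noteq> 0" "y \<noteq> 0" and xs: "xs \<in> compositions"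
    using 3 by simp_all
  then have "x = 1" "y = 1" "sum_list xs = 0" by linarith+
  then show ?thesis using 3 sum_list_eq_0_composition[OF xs] by simp
qed auto

lemma comp_compl_2: "comp_compl [2] = [1, 1]" "comp_compl [1, 1] = [2]"
proof -
  have "comp_compl [1] = [1]" using comp_compl_one_Cons[of "[]"] by simp
  then show "comp_compl [2] = [1, 1]"
    using comp_compl_incr[of "[1]"] by (simp add: numeral_2_eq_2)
  then show "comp_compl [1, 1] = [2]" using comp_compl_involution[of "[2]"] by simp
qed

theorem theorem5p5:
  fixes \<Psi> :: "qsym \<Rightarrow> qsym"
  assumes "Vector_Spaces.linear qscale qscale \<Psi>"
    and "\<forall>\<alpha>\<in>compositions. \<Psi> (qsym_F \<alpha>) = qsym_F (comp_compl \<alpha>)"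
  shows "(hopf_automorphism \<Psi> \<and> graded \<Psi> \<and>
            \<Psi> ` qsym_F ` compositions = qsym_F ` compositions \<and> \<Psi> \<noteq> id) \<and>
         (\<forall>\<phi>. hopf_automorphism \<phi> \<and> graded \<phi> \<and>
            \<phi> ` qsym_F ` compositions = qsym_F ` compositions \<and> \<phi> \<noteq> id \<longrightarrow> \<phi> = \<Psi>)"
proof (intro conjI allI impI)
  note lin = assms(1) and compl = assms(2)
  have bij: "bij \<Psi>" using compl_map_involution[OF assms] by (rule involuntory_imp_bij)
  show hopf: "hopf_automorphism \<Psi>"
    unfolding hopf_automorphism_def
    using bij lin compl_map_one[OF assms] compl_map_times[OF assms] counit_compl_map[OF assms]
      comult_compl_map[OF assms] by blast
  show graded: "graded \<Psi>" by (rule graded_compl_map[OF assms])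
  show image: "\<Psi> ` qsym_F ` compositions = qsym_F ` compositions"
  proof -
    have "\<Psi> ` qsym_F ` compositions = qsym_F ` comp_compl ` compositions"
      using compl by (simp add: image_image)
    then show ?thesis by (simp add: comp_compl_image)
  qed
  have distinct: "qsym_F [1, 1] \<noteq> qsym_F [2]"
    using inj_onD[OF inj_on_qsym_F, of "[1, 1]" "[2]"] by auto
  have two: "\<Psi> (qsym_F [2]) = qsym_F [1, 1]" "\<Psi> (qsym_F [1, 1]) = qsym_F [2]"
    using compl by (simp_all add: comp_compl_2[unfolded One_nat_def])
  show "\<Psi> \<noteq> id" using two distinct by auto
  fix \<phi>
  assume "hopf_automorphism \<phi> \<and> graded \<phi> \<and> \<phi> ` qsym_F ` compositions = qsym_F ` compositions \<and> \<phi> \<noteq> id"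
  then have \<phi>: "hopf_automorphism \<phi>" "graded \<phi>" "\<phi> ` qsym_F ` compositions = qsym_F ` compositions" "\<phi> \<noteq> id"
    by blast+
  have lin\<phi>: "Vector_Spaces.linear qscale qscale \<phi>" and "inj \<phi>"
    using \<phi>(1) by (auto simp: hopf_automorphism_def bij_def)
  have comult: "comult (\<chi> (qsym_F \<alpha>)) = (\<Sum>(x, y)\<leftarrow>cuts \<alpha>. tensor (\<chi> (qsym_F x)) (\<chi> (qsym_F y)))"
    if "hopf_automorphism \<chi>" "\<alpha> \<in> compositions" for \<chi> \<alpha>
    using that tensor_map_comult_F[of \<chi> \<alpha>] by (simp add: hopf_automorphism_def)
  have deg2: "\<phi> (qsym_F \<alpha>) \<in> {qsym_F [2], qsym_F [1, 1]}" if "\<alpha> \<in> compositions" "sum_list \<alpha> = 2" for \<alpha>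
    using graded_map_F[OF \<phi>(2) _ that(1)] \<phi>(3) that(2) compositions_of_2 by (metis insertCI order_refl)
  have "\<phi> (qsym_F [1, 1]) \<noteq> \<phi> (qsym_F [2])" using \<open>inj \<phi>\<close> distinct by (auto dest: injD)
  then consider "\<phi> (qsym_F [2]) = qsym_F [2]" "\<phi> (qsym_F [1, 1]) = qsym_F [1, 1]"
    | "\<phi> (qsym_F [2]) = qsym_F [1, 1]" "\<phi> (qsym_F [1, 1]) = qsym_F [2]"
    using deg2[of "[2]"] deg2[of "[1, 1]"] by auto
  then show "\<phi> = \<Psi>"
  proof cases
    case 1
    have "\<phi> = id"
    proof (rule graded_coalgebra_map_eqI[OF lin\<phi>])
      show "Vector_Spaces.linear qscale qscale id" by unfold_locales simp_all
      show "\<phi> (qsym_F \<alpha>) = id (qsym_F \<alpha>)" if "\<alpha> \<in> compositions" "sum_list \<alpha> = 2" for \<alpha>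
        using compositions_of_2[OF that] 1 by auto
    qed (use \<phi> comult comult_F in \<open>simp_all add: graded_def\<close>)
    then show ?thesis using \<phi>(4) by blast
  next
    case 2
    show ?thesis
    proof (rule graded_coalgebra_map_eqI[OF lin\<phi> lin])
      show "\<phi> (qsym_F \<alpha>) = \<Psi> (qsym_F \<alpha>)" if "\<alpha> \<in> compositions" "sum_list \<alpha> = 2" for \<alpha>
        using compositions_of_2[OF that] 2 two by auto
    qed (use \<phi> comult hopf graded image in simp_all)
  qed
qed

end
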